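(* Let $G$ be a finite group such that $Sub(G) < 59$. Then $G$ is solvable.
   Context: For a finite group $G$, $Sub(G)$ denotes the number of subgroups of $G$, including the trivial subgroup and $G$ itself (subgroups are counted as subsets, not up to conjugacy or isomorphism). *)

theory Defs
  imports "HOL-Algebra.Solvable_Groups"
begin

definition Sub :: "('a, 'b) monoid_scheme \<Rightarrow> nat" where
  "Sub G = card {H. subgroup H G}"

end

theory Submission
  imports Defs "HOL-Algebra.Sylow" "HOL-Algebra.Zassenhaus" "HOL-Algebra.SimpleGroups"
    "HOL-Algebra.Multiplicative_Group" "HOL-Combinatorics.Permutations"
begin

text \<open>
  The derived series of a finite group that is not solvable becomes stationary at a perfect
  subgroup \<open>D \<noteq> 1\<close>, and the quotient of \<open>D\<close> by a maximal normal subgroup is simple and nonabelian.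
  Neither a subgroup nor a quotient of a group has more subgroups than the group itself. So it is
  enough that a finite nonabelian simple group \<open>G\<close> has at least 59 subgroups, the number
  that the alternating group of degree five has.

  No classification of simple groups enters; the subgroups are counted order by order. Let \<open>t(d)\<close>
  (\<open>num_subgroups\<close>) be the number of subgroups of order \<open>d\<close>. If there were fewer than 59 subgroups,
  then the sum of \<open>t(d)\<close> over any set of orders \<open>d\<close> other than \<open>1\<close> and \<open>|G|\<close> would be at
  most 56. Four facts bound \<open>t\<close> from below.

  \<^item> \<open>G\<close> acts faithfully on the conjugates of a proper nontrivial subgroup of order \<open>d\<close>, so \<open>|G|\<close>
    divides \<open>t(d)!\<close> (\<open>order_dvd_fact_num\<close>). Hence \<open>t(d) \<ge> 5\<close>, and \<open>t(d) \<ge> j p\<close> if \<open>p\<^sup>j\<close> divides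
    \<open>|G|\<close> and \<open>j \<le> p\<close>.
  \<^item> For a Sylow subgroup of order \<open>p\<^sup>a\<close>, the number \<open>n = t(p\<^sup>a)\<close> is \<open>1\<close> modulo \<open>p\<close> and divides
    \<open>|G| / p\<^sup>a\<close>, and the \<open>n\<close> normalizers are different subgroups of order \<open>|G| / n\<close>
    (\<open>sylow_numbers\<close>).
  \<^item> A Sylow subgroup is never central in its normalizer, by Burnside's transfer theorem
    (\<open>burnside_transfer\<close>). If its order is \<open>p\<close> or \<open>p\<^sup>2\<close> it is abelian, so the
    normalizers are a second class of at least \<open>n\<close> subgroups.
  \<^item> If \<open>p\<close> divides \<open>|G|\<close> exactly once, then some subgroup \<open>Q\<close> of prime power order normalizes a
    Sylow \<open>p\<close>-subgroup without centralizing it, and such a \<open>Q\<close> has at least \<open>p (p + 1) / 2\<close>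
    conjugates (\<open>num_ge_conjugates_of_acting_subgroup\<close>).

  With these bounds the budget of 56 excludes all prime divisors from 11 on, then the divisors 25, 7
  and 5, and finally the orders \<open>2\<^sup>a 3\<^sup>b\<close>. The tight case is \<open>|G| = 60\<close>, where the orders
  5, 10, 2, 3, 6, 4 and 12 contribute \<open>6 + 6 + 15 + 10 + 10 + 5 + 5 = 57\<close>.
\<close>

section \<open>Group actions and conjugation\<close>

context group
begin

text \<open>
  Actions are plain functions, restricted to a subgroup \<open>K\<close> of the ambient group, so that different
  subgroups can act by the same formula on the same set.
\<close>

definition acts_on :: "'a set \<Rightarrow> 'x set \<Rightarrow> ('a \<Rightarrow> 'x \<Rightarrow> 'x) \<Rightarrow> bool" where
  "acts_on K E a \<longleftrightarrow> subgroup K G \<and> (\<forall>g\<in>K. \<forall>x\<in>E. a g x \<in> E) \<and> (\<forall>x\<in>E. a \<one> x = x) \<and>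
     (\<forall>g\<in>K. \<forall>h\<in>K. \<forall>x\<in>E. a (g \<otimes> h) x = a g (a h x))"

lemma orbit_stabilizer:
  assumes act: "acts_on K E a" and fin: "finite K" and x: "x \<in> E"
  shows "card ((\<lambda>g. a g x) ` K) * card {g\<in>K. a g x = x} = card K"
proof -
  have K: "subgroup K G" using act by (simp add: acts_on_def)
  have fib: "card {g\<in>K. a g x = y} = card {g\<in>K. a g x = x}" if y: "y \<in> (\<lambda>g. a g x) ` K" for y
  proof -
    obtain h where h: "h \<in> K" "y = a h x" using y by blast
    have hG: "h \<in> carrier G" using h K subgroup.mem_carrier by fastforce
    have "bij_betw (\<lambda>g. h \<otimes> g) {g\<in>K. a g x = x} {g\<in>K. a g x = y}"
    proof (rule bij_betwI[where g = "\<lambda>g. inv h \<otimes> g"])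
      show "(\<lambda>g. h \<otimes> g) \<in> {g \<in> K. a g x = x} \<rightarrow> {g \<in> K. a g x = y}"
        using act x h K by (auto simp: acts_on_def subgroup.m_closed)
      show "(\<lambda>g. inv h \<otimes> g) \<in> {g \<in> K. a g x = y} \<rightarrow> {g \<in> K. a g x = x}"
      proof clarsimp
        fix g assume g: "g \<in> K" "y = a g x"
        have i: "inv h \<in> K" using h K by (simp add: subgroup.m_inv_closed)
        have "a (inv h \<otimes> g) x = a (inv h) (a h x)"
          using act i g x h by (simp add: acts_on_def)
        also have "\<dots> = a (inv h \<otimes> h) x" using act i h x by (simp add: acts_on_def)
        also have "\<dots> = x" using hG act x by (simp add: acts_on_def)
        finally show "inv h \<otimes> g \<in> K \<and> a (inv h \<otimes> g) x = x"
          using i g K by (simp add: subgroup.m_closed)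
      qed
    qed (use hG K subgroup.mem_carrier in \<open>fastforce simp flip: m_assoc\<close>)+
    then show ?thesis by (simp add: bij_betw_same_card)
  qed
  have "card K = (\<Sum>y\<in>(\<lambda>g. a g x) ` K. card {g\<in>K. a g x = y})"
    using sum.image_gen[OF fin, of "\<lambda>_. 1::nat" "\<lambda>g. a g x"] by simp
  also have "\<dots> = (\<Sum>y\<in>(\<lambda>g. a g x) ` K. card {g\<in>K. a g x = x})"
    by (rule sum.cong) (use fib in auto)
  finally show ?thesis by simp
qed

text \<open>
  The orbits of size greater than one have sizes divisible by \<open>p\<close>.
\<close>

lemma p_group_fixed_points:
  assumes act: "acts_on K E a" and cK: "card K = p ^ i" and p: "prime p" and fin: "finite E"
  shows "card E mod p = card {x\<in>E. \<forall>g\<in>K. a g x = x} mod p"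
proof -
  let ?F = "{x\<in>E. \<forall>g\<in>K. a g x = x}"
  let ?C = "(\<lambda>x. (\<lambda>g. a g x) ` K) ` (E - ?F)"
  have K: "subgroup K G" using act by (simp add: acts_on_def)
  have finK: "finite K" using cK p by (metis card.infinite not_prime_0 power_eq_0_iff)
  have oneK: "\<one> \<in> K" using K by (simp add: subgroup.one_closed)
  have one: "a \<one> x = x" if "x \<in> E" for x using act that by (simp add: acts_on_def)
  have mult: "a (g \<otimes> h) x = a g (a h x)" if "g \<in> K" "h \<in> K" "x \<in> E" for g h x
    using act that by (simp add: acts_on_def)
  have cl: "a g x \<in> E" if "g \<in> K" "x \<in> E" for g x using act that by (simp add: acts_on_def)
  have inv: "a (inv g) (a g x) = x" if "g \<in> K" "x \<in> E" for g x
    using that mult[of "inv g" g x] one[of x] K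
    by (metis l_inv subgroup.m_inv_closed subgroup.mem_carrier)
  have orb: "(\<lambda>g. a g (a h x)) ` K = (\<lambda>g. a g x) ` K" if "h \<in> K" "x \<in> E" for h x
  proof -
    have *: "(\<lambda>g. a g (a h x)) ` K \<subseteq> (\<lambda>g. a g x) ` K" if "h \<in> K" "x \<in> E" for h x
      using that mult[symmetric] K by (auto simp: subgroup.m_closed)
    have "inv h \<in> K" using that K by (simp add: subgroup.m_inv_closed)
    then show ?thesis using *[of h x] *[of "inv h" "a h x"] that inv[of h x] cl by auto
  qed
  have U: "\<Union>?C = E - ?F"
  proof
    show "E - ?F \<subseteq> \<Union>?C" using one oneK by force
    show "\<Union>?C \<subseteq> E - ?F"
    proof (intro subsetI)
      fix y assume "y \<in> \<Union>?C"
      then obtain x h where x: "x \<in> E" "x \<notin> ?F" and h: "h \<in> K" "y = a h x" by auto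
      have "y \<notin> ?F"
      proof
        assume "y \<in> ?F"
        then have fy: "a g y = y" if "g \<in> K" for g using that by auto
        have "inv h \<in> K" using h K by (simp add: subgroup.m_inv_closed)
        then have "x = y" using inv[of h x] h x fy by metis
        with x \<open>y \<in> ?F\<close> show False by simp
      qed
      then show "y \<in> E - ?F" using x h cl by auto
    qed
  qed
  have "p dvd card (\<Union>?C)"
  proof (rule dvd_partition)
    show "finite (\<Union>?C)" using U fin by simp
    show "\<forall>c\<in>?C. p dvd card c"
    proof
      fix c assume "c \<in> ?C"
      then obtain x where x: "x \<in> E" "x \<notin> ?F" and c: "c = (\<lambda>g. a g x) ` K" by blast
      have os: "card ((\<lambda>g. a g x) ` K) * card {g\<in>K. a g x = x} = p ^ i"
        using orbit_stabilizer[OF act finK x(1)] cK by simp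
      then obtain j where j: "card ((\<lambda>g. a g x) ` K) = p ^ j"
        using divides_primepow_nat[OF p] by (metis dvd_triv_left)
      have "card ((\<lambda>g. a g x) ` K) \<noteq> 1"
      proof
        assume "card ((\<lambda>g. a g x) ` K) = 1"
        then obtain z where "(\<lambda>g. a g x) ` K = {z}" by (auto simp: card_1_singleton_iff)
        then have "\<forall>g\<in>K. a g x = a \<one> x" using oneK by (metis image_eqI singletonD)
        with x one show False by auto
      qed
      with j c show "p dvd card c" by (cases j) auto
    qed
    show "\<forall>c1\<in>?C. \<forall>c2\<in>?C. c1 \<noteq> c2 \<longrightarrow> c1 \<inter> c2 = {}"
    proof (intro ballI impI, rule ccontr)
      fix c1 c2 assume c: "c1 \<in> ?C" "c2 \<in> ?C" "c1 \<noteq> c2" "c1 \<inter> c2 \<noteq> {}"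
      then obtain x y where xy: "x \<in> E" "c1 = (\<lambda>g. a g x) ` K" "y \<in> E" "c2 = (\<lambda>g. a g y) ` K" by auto
      with c(4) obtain g h where "g \<in> K" "h \<in> K" "a g x = a h y" by auto
      with orb[of g x] orb[of h y] xy c(3) show False by metis
    qed
  qed
  then have "p dvd card E - card ?F"
    using U fin by (simp add: card_Diff_subset)
  then show ?thesis
    using fin by (simp add: card_mono mod_eq_dvd_iff_nat)
qed

abbreviation conjugate :: "'a \<Rightarrow> 'a set \<Rightarrow> 'a set" where
  "conjugate g H \<equiv> g <# H #> inv g"

lemma conjugate_eq_image: "conjugate g H = (\<lambda>h. g \<otimes> h \<otimes> inv g) ` H"
  unfolding l_coset_def r_coset_def by auto

lemma conjugate_one: "H \<subseteq> carrier G \<Longrightarrow> conjugate \<one> H = H"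
  unfolding conjugate_eq_image using image_cong[of H H "\<lambda>h. \<one> \<otimes> h \<otimes> inv \<one>" "\<lambda>h. h"]
  by (auto simp: subset_iff)

lemma conjugate_mult:
  assumes "g \<in> carrier G" "h \<in> carrier G" "H \<subseteq> carrier G"
  shows "conjugate (g \<otimes> h) H = conjugate g (conjugate h H)"
  unfolding conjugate_eq_image image_image
  by (rule image_cong) (use assms in \<open>auto simp: m_assoc inv_mult_group subset_iff\<close>)

lemma conjugate_inv_cancel:
  assumes "g \<in> carrier G" "H \<subseteq> carrier G"
  shows "conjugate (inv g) (conjugate g H) = H" "conjugate g (conjugate (inv g) H) = H"
  using assms conjugate_mult[of "inv g" g H] conjugate_mult[of g "inv g" H] conjugate_one by auto

lemma card_conjugate:
  assumes "g \<in> carrier G" "H \<subseteq> carrier G"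
  shows "card (conjugate g H) = card H"
  unfolding conjugate_eq_image
  by (rule card_image) (use assms in \<open>auto simp: inj_on_def subset_iff\<close>)

lemma subgroup_conjugate:
  assumes g: "g \<in> carrier G" and H: "subgroup H G"
  shows "subgroup (conjugate g H) G"
proof (rule subgroupI)
  note [simp] = subgroup.mem_carrier[OF H]
  show "conjugate g H \<subseteq> carrier G" using g by (auto simp: conjugate_eq_image)
  show "conjugate g H \<noteq> {}" using H subgroup.one_closed by (force simp: conjugate_eq_image)
  fix x assume "x \<in> conjugate g H"
  then obtain h where h: "h \<in> H" "x = g \<otimes> h \<otimes> inv g" by (auto simp: conjugate_eq_image)
  have "inv x = g \<otimes> inv h \<otimes> inv g" using h g by (simp add: inv_mult_group m_assoc)
  then show "inv x \<in> conjugate g H" using h H by (auto simp: conjugate_eq_image subgroup.m_inv_closed)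
  fix y assume "y \<in> conjugate g H"
  then obtain k where k: "k \<in> H" "y = g \<otimes> k \<otimes> inv g" by (auto simp: conjugate_eq_image)
  have "x \<otimes> y = g \<otimes> (h \<otimes> k) \<otimes> inv g"
  proof -
    have "inv g \<otimes> (g \<otimes> (k \<otimes> inv g)) = k \<otimes> inv g"
      using k g by (simp flip: m_assoc)
    then show ?thesis using h k g by (simp add: m_assoc)
  qed
  then show "x \<otimes> y \<in> conjugate g H" using h k H by (auto simp: conjugate_eq_image subgroup.m_closed)
qed

lemma mem_normalizer_iff:
  "H \<subseteq> carrier G \<Longrightarrow> g \<in> normalizer G H \<longleftrightarrow> g \<in> carrier G \<and> conjugate g H = H"
  by (auto simp: normalizer_def stabilizer_def)

lemma normalizer_conj_closed:
  assumes "H \<subseteq> carrier G" "g \<in> normalizer G H" "h \<in> H"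
  shows "g \<otimes> h \<otimes> inv g \<in> H"
  using assms mem_normalizer_iff[of H g] by (auto simp: conjugate_eq_image)

lemma subgroup_subset_normalizer:
  assumes "subgroup H G" shows "H \<subseteq> normalizer G H"
  using subgroup_in_normalizer[OF assms] normal_imp_subgroup subgroup.subset by fastforce

lemma acts_on_conjugate:
  assumes "subgroup K G" "\<And>H. H \<in> E \<Longrightarrow> H \<subseteq> carrier G"
    "\<And>g H. g \<in> K \<Longrightarrow> H \<in> E \<Longrightarrow> conjugate g H \<in> E"
  shows "acts_on K E conjugate"
  unfolding acts_on_def
proof (intro conjI ballI)
  show "subgroup K G" by fact
  fix H assume H: "H \<in> E"
  show "conjugate \<one> H = H" using assms(2)[OF H] by (rule conjugate_one)
  fix g assume g: "g \<in> K"
  show "conjugate g H \<in> E" using assms(3) g H .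
  fix h assume h: "h \<in> K"
  show "conjugate (g \<otimes> h) H = conjugate g (conjugate h H)"
    using conjugate_mult assms(2)[OF H] subgroup.mem_carrier[OF assms(1)] g h by blast
qed

lemma finite_subgroups: "finite (carrier G) \<Longrightarrow> finite {H. subgroup H G \<and> P H}"
  by (rule finite_subset[of _ "Pow (carrier G)"]) (auto dest: subgroup.subset)

definition conjugates :: "'a set \<Rightarrow> 'a set \<Rightarrow> 'a set set" where
  "conjugates K H = (\<lambda>g. conjugate g H) ` K"

lemma conjugates_acts_on:
  assumes K: "subgroup K G" and L: "subgroup L G" "L \<subseteq> K" and H: "subgroup H G"
  shows "acts_on L (conjugates K H) conjugate"
proof (rule acts_on_conjugate[OF L(1)])
  fix R assume "R \<in> conjugates K H"
  then obtain k where k: "k \<in> K" "R = conjugate k H" by (auto simp: conjugates_def)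
  then show "R \<subseteq> carrier G"
    using subgroup_conjugate[of k H] K H subgroup.mem_carrier subgroup.subset by metis
  fix g assume "g \<in> L"
  then have "conjugate g R = conjugate (g \<otimes> k) H"
    using k conjugate_mult[of g k H] K L H subgroup.mem_carrier subgroup.subset by metis
  moreover have "g \<otimes> k \<in> K" using \<open>g \<in> L\<close> L k K by (auto simp: subgroup.m_closed)
  ultimately show "conjugate g R \<in> conjugates K H" by (auto simp: conjugates_def)
qed

lemma card_conjugates:
  assumes K: "subgroup K G" and H: "subgroup H G" and fin: "finite (carrier G)"
  shows "card (conjugates K H) * card (K \<inter> normalizer G H) = card K"
proof -
  have HG: "H \<subseteq> carrier G" and KG: "K \<subseteq> carrier G" using H K subgroup.subset by auto
  have finK: "finite K" using KG fin finite_subset by blast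
  have a: "acts_on K (conjugates K H) conjugate"
    by (rule conjugates_acts_on) (use K H in auto)
  have "H \<in> conjugates K H"
    using conjugate_one[OF HG] K subgroup.one_closed unfolding conjugates_def by force
  from orbit_stabilizer[OF a finK this]
  have "card (conjugates K H) * card {g\<in>K. conjugate g H = H} = card K"
    by (simp add: conjugates_def)
  moreover have "{g\<in>K. conjugate g H = H} = K \<inter> normalizer G H"
    using mem_normalizer_iff[OF HG] KG by auto
  ultimately show ?thesis by simp
qed

lemma card_subgroup_dvd:
  assumes "subgroup H G" "subgroup K G" "H \<subseteq> K"
  shows "card H dvd card K"
proof -
  interpret K: group "G\<lparr>carrier := K\<rparr>" using assms subgroup_imp_group by blast
  have "subgroup H (G\<lparr>carrier := K\<rparr>)" using assms subgroup_incl by blast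
  from K.lagrange[OF this]
  have "card (rcosets\<^bsub>G\<lparr>carrier := K\<rparr>\<^esub> H) * card H = card K"
    by (simp add: order_def)
  then show ?thesis by (metis dvd_triv_right)
qed

section \<open>Sylow subgroups\<close>

text \<open>
  The product \<open>R Q\<close> is a subgroup that consists of a power of \<open>p\<close> many cosets of \<open>R\<close>, as these form
  one orbit of \<open>Q\<close>. Since \<open>R\<close> already has the largest possible power of \<open>p\<close> as its order, there is
  only one coset. In particular \<open>R\<close> is the only Sylow \<open>p\<close>-subgroup that is contained in its normalizer.
\<close>

lemma p_subgroup_of_sylow_normalizer:
  assumes fin: "finite (carrier G)" and p: "prime p" and nd: "\<not> p ^ Suc a dvd order G"
    and R: "subgroup R G" "card R = p ^ a" and Q: "subgroup Q G" "card Q = p ^ i"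
    and QN: "Q \<subseteq> normalizer G R"
  shows "Q \<subseteq> R"
proof -
  have RG: "R \<subseteq> carrier G" and QG: "Q \<subseteq> carrier G" using R Q subgroup.subset by auto
  \<comment> \<open>Right multiplication by inverses makes this a left action.\<close>
  let ?E = "(\<lambda>q. R #> q) ` Q"
  have fQ: "finite Q" using QG fin finite_subset by blast
  let ?act = "\<lambda>q C. C #> inv q"
  have act: "acts_on Q ?E ?act"
    unfolding acts_on_def
  proof (intro conjI ballI)
    show "subgroup Q G" by fact
    fix C assume "C \<in> ?E"
    then obtain q where q: "q \<in> Q" "C = R #> q" by auto
    then have CG: "C \<subseteq> carrier G" using RG QG r_coset_subset_G by blast
    then show "C #> inv \<one> = C" by simp
    fix g assume g: "g \<in> Q"
    have "C #> inv g = R #> (q \<otimes> inv g)"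
      using q g QG RG by (simp add: coset_mult_assoc subset_iff)
    then show "C #> inv g \<in> ?E" using q g Q by (auto simp: subgroup.m_closed subgroup.m_inv_closed)
    fix h assume h: "h \<in> Q"
    show "C #> inv (g \<otimes> h) = C #> inv h #> inv g"
      using q g h QG CG by (simp add: coset_mult_assoc inv_mult_group subset_iff)
  qed
  have R1: "R = R #> \<one>" using RG by simp
  have RE: "R \<in> ?E" using R1 Q subgroup.one_closed by blast
  have orbE: "(\<lambda>g. ?act g R) ` Q = ?E"
  proof -
    have "(\<lambda>g. ?act g R) ` Q = (\<lambda>q. R #> q) ` (\<lambda>g. inv g) ` Q" by (simp add: image_image)
    moreover have "(\<lambda>g. inv g) ` Q = Q"
      using Q subgroup.m_inv_closed QG by (force simp: image_def)
    ultimately show ?thesis by simp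
  qed
  have "card ?E * card {g\<in>Q. ?act g R = R} = p ^ i"
    using orbit_stabilizer[OF act fQ RE] orbE Q by simp
  then obtain j where j: "card ?E = p ^ j"
    using divides_primepow_nat[OF p] by (metis dvd_triv_left)
  let ?K = "R <#> Q"
  have sK: "subgroup ?K G"
  proof -
    have N: "subgroup (normalizer G R) G" using normalizer_imp_subgroup RG by blast
    have nR: "R \<lhd> G\<lparr>carrier := normalizer G R\<rparr>" using subgroup_in_normalizer R by blast
    have "Q <#> R = R <#> Q"
      using commut_normal_subgroup[OF N nR] Q QN subgroup_incl[OF Q(1) N QN] by blast
    then show ?thesis
      using incl_subgroup[OF N mult_norm_sub_in_sub[OF nR subgroup_incl[OF Q(1) N QN] N]] by simp
  qed
  have KU: "?K = \<Union>?E" by (auto simp: set_mult_def r_coset_def)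
  have "card ?K = card ?E * card R"
  proof -
    have "card R * card ?E = card (\<Union>?E)"
    proof (rule card_partition)
      show "finite ?E" using fQ by simp
      show "finite (\<Union>?E)" using KU sK fin finite_subset subgroup.subset by metis
      show "card c = card R" if "c \<in> ?E" for c
        using that card_rcosets_equal[of c R] RG QG by (auto simp: rcosetsI subset_iff)
      show "c1 \<inter> c2 = {}" if "c1 \<in> ?E" "c2 \<in> ?E" "c1 \<noteq> c2" for c1 c2
      proof -
        have "c1 \<in> rcosets R" "c2 \<in> rcosets R" using that QG by (auto simp: rcosetsI RG)
        then show ?thesis using rcos_disjoint[OF R(1)] that
          by (auto simp: pairwise_def disjnt_def)
      qed
    qed
    then show ?thesis using KU by (simp add: mult.commute)
  qed
  then have "card ?K = p ^ (j + a)" using j R by (simp add: power_add)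
  then have "p ^ (j + a) dvd order G"
    using card_subgroup_dvd[OF sK subgroup_self] sK subgroup.subset by (fastforce simp: order_def)
  then have "j = 0" using nd by (metis add_Suc dvd_trans le_add2 le_imp_power_dvd not0_implies_Suc add_Suc_right add.commute)
  then have "card ?E = 1" using j by simp
  then obtain z where "?E = {z}" by (auto simp: card_1_singleton_iff)
  then have "?E = {R}" using RE by auto
  then have "R #> q = R" if "q \<in> Q" for q using that by blast
  then show "Q \<subseteq> R" using rcos_self[OF _ R(1)] QG by (metis subset_iff)
qed

text \<open>
  Sylow's second theorem relative to an intermediate subgroup \<open>K\<close>: the number of \<open>K\<close>-conjugates of
  \<open>P\<close> is prime to \<open>p\<close>, so \<open>Q\<close> normalizes one of them.
\<close>

lemma p_subgroup_in_sylow_conjugate: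
  assumes fin: "finite (carrier G)" and p: "prime p" and nd: "\<not> p ^ Suc a dvd order G"
    and K: "subgroup K G" and P: "subgroup P G" "P \<subseteq> K" "card P = p ^ a"
    and Q: "subgroup Q G" "Q \<subseteq> K" "card Q = p ^ i"
  shows "\<exists>k\<in>K. Q \<subseteq> conjugate k P"
proof -
  let ?S = "conjugates K P"
  have PG: "P \<subseteq> carrier G" and KG: "K \<subseteq> carrier G" using P K subgroup.subset by auto
  have N: "subgroup (normalizer G P) G" using normalizer_imp_subgroup PG by blast
  have KN: "subgroup (K \<inter> normalizer G P) G" using subgroups_Inter_pair[OF K N] .
  have "P \<subseteq> K \<inter> normalizer G P" using P subgroup_subset_normalizer by auto
  from card_subgroup_dvd[OF P(1) KN this] obtain c where c: "card (K \<inter> normalizer G P) = p ^ a * c"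
    using P by (auto elim: dvdE)
  have ck: "card ?S * card (K \<inter> normalizer G P) = card K" by (rule card_conjugates[OF K P(1) fin])
  have ndS: "\<not> p dvd card ?S"
  proof
    assume "p dvd card ?S"
    then have "p ^ Suc a dvd card ?S * card (K \<inter> normalizer G P)" using c by (simp add: mult_dvd_mono)
    then have "p ^ Suc a dvd card K" using ck by simp
    then show False
      using nd card_subgroup_dvd[OF K subgroup_self KG] by (auto simp: order_def)
  qed
  have finS: "finite ?S" unfolding conjugates_def using KG fin finite_subset by blast
  have act: "acts_on Q ?S conjugate" by (rule conjugates_acts_on) (use K P Q in auto)
  have "card ?S mod p = card {x\<in>?S. \<forall>g\<in>Q. conjugate g x = x} mod p"
    by (rule p_group_fixed_points[OF act Q(3) p finS])
  then have "card {x\<in>?S. \<forall>g\<in>Q. conjugate g x = x} \<noteq> 0"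
    using ndS by (metis dvd_eq_mod_eq_0 mod_0)
  then have "{x\<in>?S. \<forall>g\<in>Q. conjugate g x = x} \<noteq> {}" by force
  then obtain k where k: "k \<in> K" "\<forall>g\<in>Q. conjugate g (conjugate k P) = conjugate k P"
    by (auto simp: conjugates_def)
  have kG: "k \<in> carrier G" using k KG by auto
  have R: "subgroup (conjugate k P) G" using subgroup_conjugate[OF kG P(1)] .
  have "Q \<subseteq> normalizer G (conjugate k P)"
    using k mem_normalizer_iff[OF subgroup.subset[OF R]] Q subgroup.subset by blast
  then have "Q \<subseteq> conjugate k P"
    using p_subgroup_of_sylow_normalizer[OF fin p nd R _ Q(1,3)] card_conjugate[OF kG PG] P by simp
  then show ?thesis using k by blast
qed


definition num_subgroups :: "nat \<Rightarrow> nat" where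
  "num_subgroups d = card {H. subgroup H G \<and> card H = d}"

lemma sylow_conjugates:
  assumes fin: "finite (carrier G)" and p: "prime p" and nd: "\<not> p ^ Suc a dvd order G"
    and P: "subgroup P G" "card P = p ^ a"
  shows "{H. subgroup H G \<and> card H = p ^ a} = conjugates (carrier G) P"
proof
  have PG: "P \<subseteq> carrier G" using P subgroup.subset by auto
  show "conjugates (carrier G) P \<subseteq> {H. subgroup H G \<and> card H = p ^ a}"
    using P PG subgroup_conjugate card_conjugate by (auto simp: conjugates_def)
  show "{H. subgroup H G \<and> card H = p ^ a} \<subseteq> conjugates (carrier G) P"
  proof clarify
    fix Q assume Q: "subgroup Q G" "card Q = p ^ a"
    then obtain g where g: "g \<in> carrier G" "Q \<subseteq> conjugate g P"
      using p_subgroup_in_sylow_conjugate[OF fin p nd subgroup_self P(1) PG P(2) Q(1) _ Q(2)] subgroup.subset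
      by blast
    have "finite (conjugate g P)" using PG fin finite_subset by (auto simp: conjugate_eq_image)
    then have "Q = conjugate g P"
      using card_subset_eq g Q P card_conjugate[OF g(1) PG] by metis
    then show "Q \<in> conjugates (carrier G) P" using g by (auto simp: conjugates_def)
  qed
qed

lemma num_sylow_times_normalizer:
  assumes fin: "finite (carrier G)" and p: "prime p" and nd: "\<not> p ^ Suc a dvd order G"
    and P: "subgroup P G" "card P = p ^ a"
  shows "num_subgroups (p ^ a) * card (normalizer G P) = order G"
proof -
  have "carrier G \<inter> normalizer G P = normalizer G P"
    using normalizer_imp_subgroup subgroup.subset P by blast
  then show ?thesis
    using card_conjugates[OF subgroup_self P(1) fin]
    by (simp add: num_subgroups_def sylow_conjugates[OF assms] order_def)
qed

text \<open>
  Among the Sylow subgroups, \<open>P\<close> normalizes only itself.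
\<close>

lemma num_sylow_mod:
  assumes fin: "finite (carrier G)" and p: "prime p" and nd: "\<not> p ^ Suc a dvd order G"
    and P: "subgroup P G" "card P = p ^ a"
  shows "num_subgroups (p ^ a) mod p = 1"
proof -
  let ?S = "{H. subgroup H G \<and> card H = p ^ a}"
  have PG: "P \<subseteq> carrier G" using P subgroup.subset by auto
  have act: "acts_on P ?S conjugate"
    unfolding sylow_conjugates[OF assms] by (rule conjugates_acts_on) (use P PG subgroup_self in auto)
  have "{R\<in>?S. \<forall>g\<in>P. conjugate g R = R} = {P}"
  proof
    show "{P} \<subseteq> {R\<in>?S. \<forall>g\<in>P. conjugate g R = R}"
      using P subgroup_subset_normalizer[OF P(1)] mem_normalizer_iff[OF PG] by auto
    show "{R\<in>?S. \<forall>g\<in>P. conjugate g R = R} \<subseteq> {P}"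
    proof clarify
      fix R assume R: "subgroup R G" "card R = p ^ a" "\<forall>g\<in>P. conjugate g R = R"
      have "P \<subseteq> normalizer G R"
        using R PG mem_normalizer_iff[OF subgroup.subset[OF R(1)]] by auto
      then have "P \<subseteq> R" using p_subgroup_of_sylow_normalizer[OF fin p nd R(1,2) P] by simp
      moreover have "finite R" using R fin finite_subset subgroup.subset by metis
      ultimately show "R = P" using card_subset_eq R P by metis
    qed
  qed
  then show ?thesis
    using p_group_fixed_points[OF act P(2) p finite_subgroups[OF fin]] prime_gt_1_nat[OF p]
    by (simp add: num_subgroups_def)
qed

text \<open>
  A Sylow subgroup can be recovered from its normalizer, in which it is the only one.
\<close>

lemma num_sylow_le_num_normalizers:
  assumes fin: "finite (carrier G)" and p: "prime p" and nd: "\<not> p ^ Suc a dvd order G"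
    and P: "subgroup P G" "card P = p ^ a"
  shows "num_subgroups (p ^ a) \<le> num_subgroups (order G div num_subgroups (p ^ a))"
proof -
  let ?S = "{H. subgroup H G \<and> card H = p ^ a}" and ?d = "order G div num_subgroups (p ^ a)"
  have inj: "inj_on (normalizer G) ?S"
  proof (rule inj_onI, clarify)
    fix R Q assume RQ: "subgroup R G" "card R = p ^ a" "subgroup Q G" "card Q = p ^ a"
      and eq: "normalizer G R = normalizer G Q"
    then have "Q \<subseteq> normalizer G R" using subgroup_subset_normalizer by auto
    then have "Q \<subseteq> R" using p_subgroup_of_sylow_normalizer[OF fin p nd RQ(1,2,3,4)] by simp
    moreover have "finite R" using RQ fin finite_subset subgroup.subset by metis
    ultimately show "R = Q" using card_subset_eq RQ by metis
  qed
  have sub: "normalizer G ` ?S \<subseteq> {H. subgroup H G \<and> card H = ?d}"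
  proof clarify
    fix R assume R: "subgroup R G" "card R = p ^ a"
    have "0 < order G" using fin order_gt_0_iff_finite by simp
    then have "card (normalizer G R) = ?d"
      using num_sylow_times_normalizer[OF fin p nd R]
      by (metis nonzero_mult_div_cancel_left mult_0 less_not_refl)
    then show "subgroup (normalizer G R) G \<and> card (normalizer G R) = ?d"
      using normalizer_imp_subgroup R subgroup.subset by auto
  qed
  have "card ?S \<le> card {H. subgroup H G \<and> card H = ?d}"
    by (rule card_inj_on_le[OF inj sub finite_subgroups[OF fin]])
  then show ?thesis by (simp only: num_subgroups_def)
qed

section \<open>Burnside's transfer theorem\<close>

lemma centralizer_subgroup:
  assumes "x \<in> carrier G"
  shows "subgroup {g \<in> carrier G. g \<otimes> x = x \<otimes> g} G"
proof (rule subgroupI)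
  show "{g \<in> carrier G. g \<otimes> x = x \<otimes> g} \<noteq> {}" using assms by auto
  fix g assume g: "g \<in> {g \<in> carrier G. g \<otimes> x = x \<otimes> g}"
  then have "x = inv g \<otimes> (x \<otimes> g)" using assms by (simp add: inv_solve_left)
  then have "x \<otimes> inv g = inv g \<otimes> x" using g assms by (metis (no_types, lifting) inv_closed inv_solve_right m_assoc m_closed mem_Collect_eq)
  then show "inv g \<in> {g \<in> carrier G. g \<otimes> x = x \<otimes> g}" using g by simp
  fix h assume h: "h \<in> {g \<in> carrier G. g \<otimes> x = x \<otimes> g}"
  then show "g \<otimes> h \<in> {g \<in> carrier G. g \<otimes> x = x \<otimes> g}"
    using g assms by (simp add: m_assoc) (simp add: m_assoc[symmetric])
qed auto

text \<open>
  Burnside's fusion argument: both \<open>P\<close> and its conjugate by \<open>g\<close> are Sylow subgroups of the centralizer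
  of \<open>g y g\<^sup>-\<^sup>1\<close>. An element \<open>c\<close> of this centralizer makes them equal, so \<open>c g\<close> normalizes \<open>P\<close>,
  and thus it commutes with \<open>y\<close>.
\<close>

lemma fusion_in_normalizer:
  assumes fin: "finite (carrier G)" and p: "prime p" and nd: "\<not> p ^ Suc a dvd order G"
    and P: "subgroup P G" "card P = p ^ a"
    and cen: "\<And>g x. g \<in> normalizer G P \<Longrightarrow> x \<in> P \<Longrightarrow> g \<otimes> x = x \<otimes> g"
    and y: "y \<in> P" and g: "g \<in> carrier G" and gy: "g \<otimes> y \<otimes> inv g \<in> P"
  shows "g \<otimes> y \<otimes> inv g = y"
proof -
  let ?z = "g \<otimes> y \<otimes> inv g"
  let ?C = "{h \<in> carrier G. h \<otimes> ?z = ?z \<otimes> h}"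
  have PG: "P \<subseteq> carrier G" using P subgroup.subset by auto
  note [simp] = subgroup.mem_carrier[OF P(1)]
  have comm: "u \<otimes> v = v \<otimes> u" if "u \<in> P" "v \<in> P" for u v
    using cen that subgroup_subset_normalizer[OF P(1)] by blast
  have C: "subgroup ?C G" by (rule centralizer_subgroup) (use y g in auto)
  have PC: "P \<subseteq> ?C" using comm gy PG by auto
  have Q: "subgroup (conjugate g P) G" "card (conjugate g P) = p ^ a"
    using subgroup_conjugate card_conjugate P PG g by auto
  have QC: "conjugate g P \<subseteq> ?C"
  proof
    fix w assume "w \<in> conjugate g P"
    then obtain h where h: "h \<in> P" "w = g \<otimes> h \<otimes> inv g" by (auto simp: conjugate_eq_image)
    have c: "inv g \<otimes> (g \<otimes> v) = v" if "v \<in> carrier G" for v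
      using g that by (simp flip: m_assoc)
    have "w \<otimes> ?z = g \<otimes> (h \<otimes> y) \<otimes> inv g" using h y g by (simp add: m_assoc c)
    also have "\<dots> = ?z \<otimes> w" using h y g comm[OF h(1) y] by (simp add: m_assoc c)
    finally show "w \<in> ?C" using h g by simp
  qed
  obtain c where c: "c \<in> ?C" "P \<subseteq> conjugate c (conjugate g P)"
    using p_subgroup_in_sylow_conjugate[OF fin p nd C Q(1) QC Q(2) P(1) PC P(2)] by blast
  have cG: "c \<in> carrier G" using c by simp
  have "P = conjugate (c \<otimes> g) P"
  proof (rule card_subset_eq)
    show "finite (conjugate (c \<otimes> g) P)"
      using finite_subset[OF PG fin] by (simp add: conjugate_eq_image)
    show "P \<subseteq> conjugate (c \<otimes> g) P" using c conjugate_mult[OF cG g PG] by simp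
    show "card P = card (conjugate (c \<otimes> g) P)" using card_conjugate[OF _ PG] cG g by simp
  qed
  then have "c \<otimes> g \<in> normalizer G P" using mem_normalizer_iff[OF PG] cG g by simp
  from cen[OF this y] have e: "c \<otimes> g \<otimes> y = y \<otimes> (c \<otimes> g)" .
  have "c \<otimes> ?z = ?z \<otimes> c" using c by simp
  also have "c \<otimes> ?z = c \<otimes> g \<otimes> y \<otimes> inv g" using cG g y by (simp add: m_assoc)
  also have "\<dots> = y \<otimes> c" using e cG g y by (simp add: m_assoc)
  finally show ?thesis using cG g y by (metis PG inv_closed m_closed right_cancel subsetD)
qed

text \<open>
  The transfer \<open>V\<close> of \<open>G\<close> into \<open>P\<close> is the product, over the right cosets \<open>w\<close> of \<open>P\<close>, of the elements
  \<open>t(w) g t(w g)\<^sup>-\<^sup>1\<close> for a choice of representatives \<open>t(w)\<close>. For \<open>x\<close> in \<open>P\<close> it is \<open>x\<close> to the power \<open>m\<close>.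
  The usual proof of this follows the cycles of \<open>x\<close> on the cosets. Here the representatives
  are \<open>t(w) = c(w) r(w)\<close> with \<open>r(w)\<close> in \<open>P\<close> and with \<open>c(w)\<close> depending only on the double coset of \<open>w\<close>. Each
  factor is then conjugate by \<open>c(w)\<close> to \<open>r(w) x r(w x)\<^sup>-\<^sup>1\<close>, and it equals this element because there is no
  fusion outside the normalizer; in the product all \<open>r(w)\<close> cancel. So \<open>V\<close> is injective
  on \<open>P\<close>, and its kernel is the normal complement.
\<close>

theorem burnside_transfer:
  assumes fin: "finite (carrier G)" and p: "prime p" and m: "order G = p ^ a * m" "\<not> p dvd m"
    and P: "subgroup P G" "card P = p ^ a"
    and cen: "\<And>g x. g \<in> normalizer G P \<Longrightarrow> x \<in> P \<Longrightarrow> g \<otimes> x = x \<otimes> g"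
  shows "\<exists>N. N \<lhd> G \<and> card N = m"
proof -
  have nd: "\<not> p ^ Suc a dvd order G" using m p by (simp add: mult.commute prime_gt_0_nat)
  have PG: "P \<subseteq> carrier G" using P subgroup.subset by auto
  note mem[simp] = subgroup.mem_carrier[OF P(1)]
  note Pcl = subgroup.m_closed[OF P(1)] subgroup.m_inv_closed[OF P(1)]
  let ?A = "G\<lparr>carrier := P\<rparr>"
  have comm: "u \<otimes> v = v \<otimes> u" if "u \<in> P" "v \<in> P" for u v
    using cen that subgroup_subset_normalizer[OF P(1)] by blast
  interpret A: group ?A using subgroup_imp_group[OF P(1)] .
  interpret A: comm_group ?A by (rule A.group_comm_groupI) (use comm in auto)
  define \<Omega> where "\<Omega> = rcosets P"
  have card\<Omega>: "card \<Omega> = m"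
  proof -
    have "card \<Omega> * p ^ a = p ^ a * m" using lagrange[OF P(1)] P m by (simp add: \<Omega>_def)
    then show ?thesis using p by (simp add: prime_gt_0_nat)
  qed
  have fin\<Omega>: "finite \<Omega>"
    unfolding \<Omega>_def using finite_subset[OF rcosets_subset_PowG[OF P(1)]] fin by blast
  have \<Omega>G: "w \<subseteq> carrier G" if "w \<in> \<Omega>" for w
    using that P subgroup.rcosets_carrier is_group by (auto simp: \<Omega>_def)
  have shift: "w #> g \<in> \<Omega>" if "w \<in> \<Omega>" "g \<in> carrier G" for w g
    using that PG by (auto simp: \<Omega>_def RCOSETS_def coset_mult_assoc)
  have bij: "bij_betw (\<lambda>w. w #> g) \<Omega> \<Omega>" if "g \<in> carrier G" for g
    by (rule bij_betwI[where g = "\<lambda>w. w #> inv g"])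
      (use that shift \<Omega>G in \<open>auto simp: coset_mult_assoc\<close>)
  \<comment> \<open>Representatives of cosets in one double coset differ by an element of \<open>P\<close> on the right.\<close>
  define c where "c w = (SOME g. g \<in> w <#> P)" for w
  define r where "r w = (SOME h. h \<in> P \<and> c w \<otimes> h \<in> w)" for w
  define t where "t w = c w \<otimes> r w" for w
  have c: "c w \<in> w <#> P" if w: "w \<in> \<Omega>" for w
  proof -
    obtain x where "x \<in> w" using w subgroup.rcosets_non_empty[OF P(1)] by (auto simp: \<Omega>_def)
    then have "x \<otimes> \<one> \<in> w <#> P" using P subgroup.one_closed by (force simp: set_mult_def)
    then show ?thesis unfolding c_def by (rule someI)
  qed
  have r: "r w \<in> P \<and> c w \<otimes> r w \<in> w" if w: "w \<in> \<Omega>" for w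
  proof -
    obtain x h where "x \<in> w" "h \<in> P" "c w = x \<otimes> h" using c[OF w] by (auto simp: set_mult_def)
    moreover have "x \<otimes> h \<otimes> inv h = x"
      using \<open>x \<in> w\<close> \<open>h \<in> P\<close> \<Omega>G[OF w] by (auto simp: m_assoc)
    ultimately have "inv h \<in> P \<and> c w \<otimes> inv h \<in> w" using Pcl by simp
    then show ?thesis unfolding r_def by (rule someI)
  qed
  have cG: "c w \<in> carrier G" if w: "w \<in> \<Omega>" for w
    using c[OF w] \<Omega>G[OF w] by (auto simp: set_mult_def)
  have tG: "t w \<in> carrier G" and tw: "t w \<in> w" if w: "w \<in> \<Omega>" for w
    using r[OF w] cG[OF w] by (auto simp: t_def)
  have wt: "w = P #> t w" if w: "w \<in> \<Omega>" for w
  proof -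
    obtain x where x: "x \<in> carrier G" "w = P #> x" using w by (auto simp: \<Omega>_def RCOSETS_def)
    then show ?thesis using repr_independence[of "t w" P x] tw[OF w] P by simp
  qed
  define f where "f g w = t w \<otimes> g \<otimes> inv (t (w #> g))" for g w
  have fP: "f g w \<in> P" if g: "g \<in> carrier G" and w: "w \<in> \<Omega>" for g w
  proof -
    have "t w \<otimes> g \<in> w #> g" using tw[OF w] by (auto simp: r_coset_def)
    then have "t w \<otimes> g \<in> P #> t (w #> g)" using wt[OF shift[OF w g]] by simp
    then show ?thesis
      unfolding f_def using subgroup.rcos_module_imp[OF P(1) is_group tG[OF shift[OF w g]]] by blast
  qed
  define V where "V g = finprod ?A (f g) \<Omega>" for g
  have VP: "V g \<in> P" if "g \<in> carrier G" for g
    using A.finprod_closed[of "f g" \<Omega>] fP that by (auto simp: V_def)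
  have hom: "V (g \<otimes> h) = V g \<otimes> V h" if g: "g \<in> carrier G" and h: "h \<in> carrier G" for g h
  proof -
    have "f (g \<otimes> h) w = f g w \<otimes> f h (w #> g)" if w: "w \<in> \<Omega>" for w
    proof -
      have s: "inv (t (w #> g)) \<otimes> (t (w #> g) \<otimes> v) = v" if "v \<in> carrier G" for v
        using that tG[OF shift[OF w g]] by (simp flip: m_assoc)
      have "w #> (g \<otimes> h) = w #> g #> h" using coset_mult_assoc[OF \<Omega>G[OF w] g h] by simp
      then show ?thesis
        using g h tG[OF w] tG[OF shift[OF w g]] tG[OF shift[OF shift[OF w g] h]]
        by (simp add: f_def m_assoc s)
    qed
    then have "V (g \<otimes> h) = finprod ?A (\<lambda>w. f g w \<otimes>\<^bsub>?A\<^esub> f h (w #> g)) \<Omega>"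
      unfolding V_def by (intro A.finprod_cong') (use fP g h shift in \<open>auto simp: Pcl\<close>)
    also have "\<dots> = finprod ?A (f g) \<Omega> \<otimes>\<^bsub>?A\<^esub> finprod ?A (\<lambda>w. f h (w #> g)) \<Omega>"
      by (rule A.finprod_multf) (use fP g h shift in auto)
    also have "finprod ?A (\<lambda>w. f h (w #> g)) \<Omega> = finprod ?A (f h) ((\<lambda>w. w #> g) ` \<Omega>)"
      by (rule A.finprod_reindex[symmetric]) (use fP h bij[OF g] shift g in \<open>auto simp: bij_betw_def\<close>)
    also have "(\<lambda>w. w #> g) ` \<Omega> = \<Omega>" using bij[OF g] by (simp add: bij_betw_def)
    finally show ?thesis by (simp add: V_def)
  qed
  have Vx: "V x = x [^]\<^bsub>?A\<^esub> m" if x: "x \<in> P" for x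
  proof -
    have xG: "x \<in> carrier G" using x by simp
    have fx: "f x w = r w \<otimes> x \<otimes> inv (r (w #> x))" if w: "w \<in> \<Omega>" for w
    proof -
      note w' = shift[OF w xG]
      have "w #> x <#> P = w <#> (x <# P)"
        using rcos_assoc_lcos[of w P x] \<Omega>G[OF w] PG xG by simp
      also have "x <# P = P" using lcos_mult_one[OF PG] l_repr_independence x P
        by (metis one_closed)
      finally have cc: "c (w #> x) = c w" by (simp add: c_def)
      let ?y = "r w \<otimes> x \<otimes> inv (r (w #> x))"
      have y: "?y \<in> P" using r[OF w] r[OF w'] x by (simp add: Pcl)
      have rr: "r w \<in> carrier G" "r (w #> x) \<in> carrier G" using r[OF w] r[OF w'] by auto
      have e: "f x w = c w \<otimes> ?y \<otimes> inv (c w)"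
        using cG[OF w] rr xG by (simp add: f_def t_def cc inv_mult_group m_assoc)
      then have "c w \<otimes> ?y \<otimes> inv (c w) \<in> P" using fP[OF xG w] by simp
      from fusion_in_normalizer[OF fin p nd P cen y cG[OF w] this] e show ?thesis by simp
    qed
    let ?r' = "\<lambda>w. inv (r (w #> x))"
    have rP: "r w \<in> P" "?r' w \<in> P" "inv (r w) \<in> P" if "w \<in> \<Omega>" for w
      using r that shift[OF that xG] Pcl by auto
    have "V x = finprod ?A (\<lambda>w. r w \<otimes>\<^bsub>?A\<^esub> x \<otimes>\<^bsub>?A\<^esub> ?r' w) \<Omega>"
      unfolding V_def by (intro A.finprod_cong') (use fx rP x in \<open>auto simp: Pcl\<close>)
    also have "\<dots> = finprod ?A (\<lambda>w. r w \<otimes>\<^bsub>?A\<^esub> x) \<Omega> \<otimes>\<^bsub>?A\<^esub> finprod ?A ?r' \<Omega>"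
      by (rule A.finprod_multf) (use rP x in \<open>auto simp: Pcl\<close>)
    also have "finprod ?A (\<lambda>w. r w \<otimes>\<^bsub>?A\<^esub> x) \<Omega> = finprod ?A r \<Omega> \<otimes>\<^bsub>?A\<^esub> finprod ?A (\<lambda>_. x) \<Omega>"
      by (rule A.finprod_multf) (use rP x in auto)
    also have "finprod ?A (\<lambda>_. x) \<Omega> = x [^]\<^bsub>?A\<^esub> m"
      using A.finprod_const[of x \<Omega>] x card\<Omega> by simp
    also have "finprod ?A ?r' \<Omega> = finprod ?A (\<lambda>w. inv (r w)) ((\<lambda>w. w #> x) ` \<Omega>)"
      by (rule A.finprod_reindex[symmetric]) (use rP bij[OF xG] in \<open>auto simp: bij_betw_def\<close>)
    also have "(\<lambda>w. w #> x) ` \<Omega> = \<Omega>" using bij[OF xG] by (simp add: bij_betw_def)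
    finally have v: "V x = finprod ?A r \<Omega> \<otimes> x [^]\<^bsub>?A\<^esub> m \<otimes> finprod ?A (\<lambda>w. inv (r w)) \<Omega>" by simp
    have cl: "finprod ?A r \<Omega> \<in> P" "finprod ?A (\<lambda>w. inv (r w)) \<Omega> \<in> P" "x [^]\<^bsub>?A\<^esub> m \<in> P"
      using A.finprod_closed[of r \<Omega>] A.finprod_closed[of "\<lambda>w. inv (r w)" \<Omega>] rP x
        A.nat_pow_closed[of x m] by auto
    have "finprod ?A r \<Omega> \<otimes>\<^bsub>?A\<^esub> finprod ?A (\<lambda>w. inv (r w)) \<Omega>
        = finprod ?A (\<lambda>w. r w \<otimes>\<^bsub>?A\<^esub> inv (r w)) \<Omega>"
      by (rule A.finprod_multf[symmetric]) (use rP in auto)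
    also have "\<dots> = finprod ?A (\<lambda>w. \<one>\<^bsub>?A\<^esub>) \<Omega>"
      by (intro A.finprod_cong') (use rP P subgroup.one_closed in \<open>auto simp: r_inv[OF mem]\<close>)
    also have "\<dots> = \<one>\<^bsub>?A\<^esub>" by (rule A.finprod_one)
    finally have one: "finprod ?A r \<Omega> \<otimes> finprod ?A (\<lambda>w. inv (r w)) \<Omega> = \<one>" by simp
    have "V x = x [^]\<^bsub>?A\<^esub> m \<otimes> (finprod ?A r \<Omega> \<otimes> finprod ?A (\<lambda>w. inv (r w)) \<Omega>)"
      using v cl comm[OF cl(1,3)] by (simp add: m_assoc)
    then show ?thesis using one cl by simp
  qed
  interpret H: group_hom G ?A V
    by unfold_locales (use VP hom in \<open>auto simp: hom_def\<close>)
  let ?N = "kernel G ?A V"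
  have inj: "inj_on V P"
  proof -
    interpret HP: group_hom ?A ?A V
      by unfold_locales (use VP hom in \<open>auto simp: hom_def\<close>)
    have "x = \<one>" if x: "x \<in> P" "V x = \<one>" for x
    proof -
      have "A.ord x dvd m" using A.pow_eq_id[of x m] x Vx by simp
      moreover have "A.ord x dvd p ^ a" using A.ord_dvd_group_order[of x] x P by (simp add: order_def)
      moreover have "coprime m (p ^ a)" using prime_imp_coprime[OF p m(2)] by (simp add: coprime_commute)
      ultimately have "A.ord x = 1" by (metis coprime_common_divisor_nat nat_dvd_1_iff_1)
      then have "x [^]\<^bsub>?A\<^esub> (1::nat) = \<one>\<^bsub>?A\<^esub>" using A.pow_eq_id[of x 1] x by simp
      then show ?thesis using x A.nat_pow_eone[of x] by simp
    qed
    then show ?thesis using HP.inj_on_one_iff by simp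
  qed
  have "V ` P \<subseteq> V ` carrier G" "V ` carrier G \<subseteq> P" using PG VP by auto
  moreover have "V ` P = P"
    by (rule endo_inj_surj[OF finite_subset[OF PG fin] _ inj]) (use VP in auto)
  ultimately have surj: "V ` carrier G = carrier ?A" by auto
  have "card (rcosets ?N) = card P"
    using iso_same_order[OF H.FactGroup_iso_set[OF surj]] by (simp add: order_def FactGroup_def)
  then have "p ^ a * card ?N = p ^ a * m"
    using lagrange[OF H.subgroup_kernel] P m by simp
  then have "card ?N = m" using p by (simp add: prime_gt_0_nat)
  then show ?thesis using H.normal_kernel by blast
qed


section \<open>Subgroups of prime order and groups of prime square order\<close>

lemma prime_order_subset:
  assumes R: "subgroup R G" "card R = p" and p: "prime p" and L: "subgroup L G"
    and c: "c \<in> R" "c \<in> L" "c \<noteq> \<one>"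
  shows "R \<subseteq> L"
proof -
  have RL: "subgroup (R \<inter> L) G" using subgroups_Inter_pair[OF R(1) L] .
  have finR: "finite R" using R p by (metis card.infinite not_prime_0)
  have "{\<one>, c} \<subseteq> R \<inter> L" using c R L subgroup.one_closed by auto
  then have "card {\<one>, c} \<le> card (R \<inter> L)" using finR by (intro card_mono) auto
  then have "card (R \<inter> L) \<noteq> 1" using c by simp
  moreover have "card (R \<inter> L) dvd p" using card_subgroup_dvd[OF RL R(1)] R by simp
  ultimately have "card (R \<inter> L) = card R" using p R by (metis prime_nat_iff)
  then have "R \<inter> L = R" using card_subset_eq[OF finR] by blast
  then show ?thesis by blast
qed

text \<open>
  The centralizer in \<open>P\<close> of a noncentral element would be a proper subgroup of \<open>P\<close> with more elements
  than the center, which has at least \<open>p\<close> elements.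
\<close>

lemma abelian_of_order_dvd_prime_square:
  assumes P: "subgroup P G" "card P = p ^ a" and p: "prime p" and a: "0 < a" "a \<le> 2"
    and xy: "x \<in> P" "y \<in> P"
  shows "x \<otimes> y = y \<otimes> x"
proof -
  note [simp] = subgroup.mem_carrier[OF P(1)]
  have finP: "finite P" using P p by (metis card.infinite not_prime_0 power_eq_0_iff)
  let ?Z = "{z\<in>P. \<forall>g\<in>P. g \<otimes> z \<otimes> inv g = z}"
  have comm_iff: "g \<otimes> z \<otimes> inv g = z \<longleftrightarrow> g \<otimes> z = z \<otimes> g" if "g \<in> P" "z \<in> P" for g z
    using that by (metis inv_solve_right subgroup.mem_carrier[OF P(1)] m_closed)
  have act: "acts_on P P (\<lambda>g x. g \<otimes> x \<otimes> inv g)"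
    using P by (auto simp: acts_on_def subgroup.m_closed subgroup.m_inv_closed m_assoc inv_mult_group)
  have "card P mod p = card ?Z mod p" by (rule p_group_fixed_points[OF act P(2) p finP])
  moreover have "card P mod p = 0" using P(2) a(1) by (simp add: dvd_power flip: dvd_eq_mod_eq_0)
  ultimately have "p dvd card ?Z" by (simp add: dvd_eq_mod_eq_0)
  moreover have "\<one> \<in> ?Z" using P subgroup.one_closed by auto
  then have "card ?Z \<noteq> 0" using finP by auto
  ultimately have pZ: "p \<le> card ?Z" by (simp add: dvd_imp_le)
  show ?thesis
  proof (rule ccontr)
    assume n: "x \<otimes> y \<noteq> y \<otimes> x"
    then have yZ: "y \<notin> ?Z" using comm_iff xy by auto
    let ?C = "P \<inter> {g \<in> carrier G. g \<otimes> y = y \<otimes> g}"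
    have C: "subgroup ?C G"
      using subgroups_Inter_pair[OF P(1) centralizer_subgroup] xy by simp
    have "insert y ?Z \<subseteq> ?C" using xy comm_iff by auto
    then have "card (insert y ?Z) \<le> card ?C" using finP by (intro card_mono) auto
    then have gt: "p < card ?C" using yZ finP pZ by simp
    have "card ?C dvd p ^ a" using card_subgroup_dvd[OF C P(1)] P by simp
    then obtain j where j: "j \<le> a" "card ?C = p ^ j" using divides_primepow_nat[OF p] by auto
    have "1 < j" using gt j p by (cases j; cases "j - 1") auto
    then have "j = a" using j(1) a(2) by linarith
    then have "card ?C = card P" using j(2) P by simp
    then have "?C = P" using card_subset_eq[OF finP] by blast
    then show False using n xy by blast
  qed
qed

section \<open>Permutation representations and subgroup counts\<close>

lemma card_Bij:
  assumes "finite S" shows "card (Bij S) = fact (card S)"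
proof -
  let ?r = "\<lambda>f. restrict f S" and ?e = "\<lambda>f x. if x \<in> S then f x else x"
  have "bij_betw ?r {f. f permutes S} (Bij S)"
  proof (rule bij_betw_byWitness[where f' = ?e])
    show "\<forall>f\<in>{f. f permutes S}. ?e (?r f) = f" by (auto simp: permutes_def fun_eq_iff)
    show "\<forall>f\<in>Bij S. ?r (?e f) = f" by (auto simp: Bij_def extensional_def fun_eq_iff)
    show "?r ` {f. f permutes S} \<subseteq> Bij S"
      by (auto simp: Bij_def permutes_imp_bij cong: bij_betw_cong)
    show "?e ` Bij S \<subseteq> {f. f permutes S}"
      by (auto simp: Bij_def intro!: bij_imp_permutes cong: bij_betw_cong)
  qed
  then show ?thesis
    using bij_betw_same_card card_permutations[OF refl assms] by metis
qed

lemma acts_on_BijGroup_hom: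
  assumes act: "acts_on (carrier G) E a"
  shows "group_hom G (BijGroup E) (\<lambda>g. \<lambda>x\<in>E. a g x)"
proof -
  have inv: "a (inv g) (a g x) = x" "a g (a (inv g) x) = x" if "g \<in> carrier G" "x \<in> E" for g x
    using that act unfolding acts_on_def by (metis inv_closed l_inv, metis inv_closed r_inv)
  have B: "(\<lambda>x\<in>E. a g x) \<in> Bij E" if g: "g \<in> carrier G" for g
  proof -
    have "bij_betw (a g) E E"
      by (rule bij_betwI[where g = "a (inv g)"]) (use g act inv in \<open>auto simp: acts_on_def\<close>)
    then show ?thesis by (auto simp: Bij_def cong: bij_betw_cong)
  qed
  show ?thesis
  proof (intro group_hom.intro group_hom_axioms.intro is_group group_BijGroup)
    show "(\<lambda>g. \<lambda>x\<in>E. a g x) \<in> hom G (BijGroup E)"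
    proof (rule homI)
      fix g h assume gh: "g \<in> carrier G" "h \<in> carrier G"
      show "(\<lambda>x\<in>E. a (g \<otimes> h) x) = (\<lambda>x\<in>E. a g x) \<otimes>\<^bsub>BijGroup E\<^esub> (\<lambda>x\<in>E. a h x)"
        using B[OF gh(1)] B[OF gh(2)] gh act
        by (auto simp: BijGroup_def compose_def acts_on_def fun_eq_iff restrict_def)
    qed (use B in \<open>auto simp: BijGroup_def\<close>)
  qed
qed

lemma sum_num_subgroups_le_Sub:
  assumes fin: "finite (carrier G)" and D: "finite D" "1 \<notin> D" "order G \<notin> D" and o: "order G \<noteq> 1"
  shows "2 + (\<Sum>d\<in>D. num_subgroups d) \<le> Sub G"
proof -
  let ?S = "\<lambda>d. {H. subgroup H G \<and> card H = d}"
  have f: "finite (?S d)" for d by (rule finite_subgroups[OF fin])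
  have pos: "num_subgroups (order G) \<ge> 1" "num_subgroups 1 \<ge> 1"
  proof -
    have "carrier G \<in> ?S (order G)" using subgroup_self by (simp add: order_def)
    moreover have "{\<one>} \<in> ?S 1" using one_is_normal normal_imp_subgroup by auto
    ultimately show "num_subgroups (order G) \<ge> 1" "num_subgroups 1 \<ge> 1"
      using f unfolding num_subgroups_def by (auto simp: Suc_le_eq card_gt_0_iff)
  qed
  let ?D = "insert 1 (insert (order G) D)"
  have "2 + (\<Sum>d\<in>D. num_subgroups d) \<le> (\<Sum>d\<in>?D. num_subgroups d)"
    using D o pos by simp
  also have "\<dots> = card (\<Union>d\<in>?D. ?S d)"
    unfolding num_subgroups_def using D f by (subst card_UN_disjoint) auto
  also have "\<dots> \<le> card {H. subgroup H G}"
    using finite_subgroups[OF fin, of "\<lambda>_. True"] by (intro card_mono) auto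
  finally show ?thesis by (simp add: Sub_def)
qed

section \<open>Subgroups acting on a Sylow subgroup of prime order\<close>

definition acts_nontrivially :: "'a set \<Rightarrow> 'a set \<Rightarrow> bool" where
  "acts_nontrivially Q P \<longleftrightarrow> subgroup Q G \<and> subgroup P G \<and> Q \<subseteq> normalizer G P \<and>
     (\<exists>x\<in>Q. \<exists>y\<in>P. x \<otimes> y \<noteq> y \<otimes> x)"

lemma conj_cancel: "g \<in> carrier G \<Longrightarrow> x \<in> carrier G \<Longrightarrow> inv g \<otimes> (g \<otimes> x) = x"
  by (simp flip: m_assoc)

lemma conj_normalizer:
  assumes "g \<in> carrier G" "P \<subseteq> carrier G" "x \<in> normalizer G P"
  shows "g \<otimes> x \<otimes> inv g \<in> normalizer G (conjugate g P)"
proof -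
  have x: "x \<in> carrier G" "conjugate x P = P" using assms mem_normalizer_iff by auto
  have gP: "conjugate g P \<subseteq> carrier G" using assms by (auto simp: conjugate_eq_image)
  have "conjugate (g \<otimes> x \<otimes> inv g) (conjugate g P) = conjugate (g \<otimes> x \<otimes> inv g \<otimes> g) P"
    using assms x by (intro conjugate_mult[symmetric]) auto
  also have "g \<otimes> x \<otimes> inv g \<otimes> g = g \<otimes> x" using assms x by (simp add: m_assoc)
  also have "conjugate (g \<otimes> x) P = conjugate g P" using assms x conjugate_mult by simp
  finally show ?thesis using mem_normalizer_iff[OF gP] assms x by simp
qed

lemma acts_nontrivially_conjugate:
  assumes "acts_nontrivially Q P" and g: "g \<in> carrier G"
  shows "acts_nontrivially (conjugate g Q) (conjugate g P)"
proof -
  have Q: "subgroup Q G" and P: "subgroup P G" and QN: "Q \<subseteq> normalizer G P"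
    using assms by (auto simp: acts_nontrivially_def)
  obtain x y where xy: "x \<in> Q" "y \<in> P" "x \<otimes> y \<noteq> y \<otimes> x"
    using assms by (auto simp: acts_nontrivially_def)
  note [simp] = subgroup.mem_carrier[OF P] subgroup.mem_carrier[OF Q]
  have e: "(g \<otimes> u \<otimes> inv g) \<otimes> (g \<otimes> v \<otimes> inv g) = g \<otimes> (u \<otimes> v) \<otimes> inv g"
    if "u \<in> carrier G" "v \<in> carrier G" for u v
    using that g by (simp add: m_assoc conj_cancel)
  have "(g \<otimes> x \<otimes> inv g) \<otimes> (g \<otimes> y \<otimes> inv g) \<noteq> (g \<otimes> y \<otimes> inv g) \<otimes> (g \<otimes> x \<otimes> inv g)"
    using xy g by (simp add: e)
  moreover have "conjugate g Q \<subseteq> normalizer G (conjugate g P)"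
    using conj_normalizer[OF g subgroup.subset[OF P]] QN by (auto simp: conjugate_eq_image)
  ultimately show ?thesis
    unfolding acts_nontrivially_def
    using subgroup_conjugate[OF g Q] subgroup_conjugate[OF g P] xy(1,2)
    by (auto simp: conjugate_eq_image)
qed

text \<open>
  A nontrivial element of \<open>P\<close> generates \<open>P\<close>, so what commutes with it centralizes \<open>P\<close>.
\<close>

lemma acts_nontrivially_no_fixed_point:
  assumes act: "acts_nontrivially Q P" and P: "card P = p" "prime p"
    and h: "h \<in> P" "\<And>x. x \<in> Q \<Longrightarrow> x \<otimes> h = h \<otimes> x"
  shows "h = \<one>"
proof (rule ccontr)
  assume "h \<noteq> \<one>"
  have sP: "subgroup P G" using act by (simp add: acts_nontrivially_def)
  note [simp] = subgroup.mem_carrier[OF sP]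
  have "x \<otimes> y = y \<otimes> x" if x: "x \<in> Q" and y: "y \<in> P" for x y
  proof -
    have xG: "x \<in> carrier G" using x act subgroup.mem_carrier by (fastforce simp: acts_nontrivially_def)
    have "P \<subseteq> {g \<in> carrier G. g \<otimes> x = x \<otimes> g}"
      by (rule prime_order_subset[OF sP P centralizer_subgroup[OF xG] h(1) _ \<open>h \<noteq> \<one>\<close>])
        (use h x in auto)
    then show ?thesis using y by auto
  qed
  then show False using act by (auto simp: acts_nontrivially_def)
qed

lemma acts_nontrivially_commutator:
  assumes act: "acts_nontrivially Q P" and h: "h \<in> P" and x: "x \<in> Q"
  shows "h \<otimes> x \<otimes> inv h \<otimes> inv x \<in> P"
proof -
  have Q: "subgroup Q G" and P: "subgroup P G" and QN: "Q \<subseteq> normalizer G P"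
    using act by (auto simp: acts_nontrivially_def)
  have "x \<otimes> inv h \<otimes> inv x \<in> P"
    using normalizer_conj_closed[OF subgroup.subset[OF P], of x "inv h"] QN x h P
    by (auto simp: subgroup.m_inv_closed)
  then have "h \<otimes> (x \<otimes> inv h \<otimes> inv x) \<in> P" using P h by (simp add: subgroup.m_closed)
  then show ?thesis
    using subgroup.mem_carrier[OF P h] subgroup.mem_carrier[OF Q x] by (simp add: m_assoc)
qed

lemma commutator_eq_one_imp:
  assumes "h \<in> carrier G" "x \<in> carrier G" "h \<otimes> x \<otimes> inv h \<otimes> inv x = \<one>"
  shows "x \<otimes> h = h \<otimes> x"
proof -
  have "h \<otimes> x \<otimes> inv h \<otimes> inv x \<otimes> x \<otimes> h = h \<otimes> x" using assms(1,2) by (simp add: m_assoc)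
  then show ?thesis using assms by simp
qed

text \<open>
  If \<open>Y\<close> normalizes \<open>R \<noteq> P\<close> and also the conjugate of \<open>R\<close> by some \<open>k\<close> in \<open>P\<close>, then this conjugate is
  normalized by the commutators of \<open>k\<close> with \<open>Y\<close>. They lie in \<open>P\<close>, and no nontrivial element of
  \<open>P\<close> normalizes a Sylow subgroup other than \<open>P\<close>. So \<open>k\<close> commutes with \<open>Y\<close>, and \<open>k = 1\<close>. Hence the
  conjugates by \<open>P\<close> of the Sylow subgroups \<open>R \<noteq> P\<close> that \<open>Y\<close> normalizes are all different.
\<close>

lemma num_normalized_sylow_bound:
  assumes fin: "finite (carrier G)" and p: "prime p" and nd: "\<not> p ^ 2 dvd order G"
    and act: "acts_nontrivially Y P" and P: "card P = p"
  shows "p * (card {R. (subgroup R G \<and> card R = p) \<and> Y \<subseteq> normalizer G R} - 1) \<le> num_subgroups p - 1"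
proof -
  let ?S = "{R. subgroup R G \<and> card R = p}"
  let ?F = "{R. (subgroup R G \<and> card R = p) \<and> Y \<subseteq> normalizer G R}"
  have sY: "subgroup Y G" and sP: "subgroup P G" and YN: "Y \<subseteq> normalizer G P"
    using act by (auto simp: acts_nontrivially_def)
  have nd': "\<not> p ^ Suc 1 dvd order G" using nd by (simp add: power2_eq_square)
  note PG[simp] = subgroup.mem_carrier[OF sP] and YG[simp] = subgroup.mem_carrier[OF sY]
  have finS: "finite ?S" by (rule finite_subgroups[OF fin])
  let ?f = "\<lambda>(R, h). conjugate h R"
  have "?f ` ((?F - {P}) \<times> P) \<subseteq> ?S - {P}"
  proof (rule image_subsetI)
    fix z assume "z \<in> (?F - {P}) \<times> P"
    then obtain R h where z: "z = (R, h)" and R: "subgroup R G" "R \<noteq> P" "card R = p" and h: "h \<in> P"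
      by auto
    have RG: "R \<subseteq> carrier G" using R subgroup.subset by auto
    have "conjugate h R \<noteq> P"
    proof
      assume "conjugate h R = P"
      then have "R = conjugate (inv h) P" using conjugate_inv_cancel(1)[of h R] h RG by simp
      moreover have "inv h \<in> normalizer G P"
        by (rule subsetD[OF subgroup_subset_normalizer[OF sP] subgroup.m_inv_closed[OF sP h]])
      ultimately show False using mem_normalizer_iff[OF subgroup.subset[OF sP]] R by simp
    qed
    then show "?f z \<in> ?S - {P}"
      using z subgroup_conjugate[of h R] card_conjugate[of h R] R h RG by simp
  qed
  moreover have "inj_on ?f ((?F - {P}) \<times> P)"
  proof (rule inj_onI)
    fix z z' assume zz: "z \<in> (?F - {P}) \<times> P" "z' \<in> (?F - {P}) \<times> P" "?f z = ?f z'"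
    then obtain R h R' h' where z: "z = (R, h)" "z' = (R', h')"
      and R: "subgroup R G" "Y \<subseteq> normalizer G R" "card R = p"
      and R': "subgroup R' G" "Y \<subseteq> normalizer G R'" "R' \<noteq> P" "card R' = p"
      and h: "h \<in> P" "h' \<in> P"
      by auto
    have eq: "conjugate h R = conjugate h' R'" using zz z by simp
    let ?k = "inv h' \<otimes> h"
    have RG: "R \<subseteq> carrier G" "R' \<subseteq> carrier G" using subgroup.subset[OF R(1)] subgroup.subset[OF R'(1)] .
    have k: "?k \<in> P" using h sP by (simp add: subgroup.m_closed subgroup.m_inv_closed)
    have kR: "conjugate ?k R = R'"
      using conjugate_mult[of "inv h'" h R] conjugate_inv_cancel(1)[of h' R'] eq h RG by simp
    have "y \<otimes> ?k = ?k \<otimes> y" if y: "y \<in> Y" for y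
    proof -
      let ?c = "?k \<otimes> y \<otimes> inv ?k \<otimes> inv y"
      have "?k \<otimes> y \<otimes> inv ?k \<in> normalizer G R'"
        using conj_normalizer[of ?k R y] kR R y k RG by auto
      moreover have "inv y \<in> normalizer G R'"
        by (rule subsetD[OF R'(2) subgroup.m_inv_closed[OF sY y]])
      ultimately have cN: "?c \<in> normalizer G R'"
        by (rule subgroup.m_closed[OF normalizer_imp_subgroup[OF RG(2)]])
      have cP: "?c \<in> P" by (rule acts_nontrivially_commutator[OF act k y])
      have "?c = \<one>"
      proof (rule ccontr)
        assume "?c \<noteq> \<one>"
        then have "P \<subseteq> normalizer G R'"
          by (rule prime_order_subset[OF sP P p normalizer_imp_subgroup[OF RG(2)] cP cN])
        then have "P \<subseteq> R'"
          using p_subgroup_of_sylow_normalizer[OF fin p nd', of R' P 1] R' R sP P by simp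
        moreover have "finite R'" using RG fin finite_subset by auto
        ultimately have "P = R'" using card_subset_eq R' R P by metis
        then show False using R' by simp
      qed
      then show ?thesis using commutator_eq_one_imp[of ?k y] k y by simp
    qed
    then have "?k = \<one>" using acts_nontrivially_no_fixed_point[OF act P p k] by simp
    then have "h = h'" using h PG by (metis inv_equality inv_inv inv_closed)
    moreover have "R = R'" using kR conjugate_one[OF RG(1)] \<open>?k = \<one>\<close> by simp
    ultimately show "z = z'" using z by simp
  qed
  ultimately have "card ((?F - {P}) \<times> P) \<le> card (?S - {P})"
    using card_inj_on_le finS by blast
  moreover have "card (?F - {P}) = card ?F - 1"
    using sP P YN by (simp add: card_Diff_singleton)
  moreover have "card (?S - {P}) = card ?S - 1"
    using sP P by (simp add: card_Diff_singleton)
  ultimately show ?thesis by (simp add: num_subgroups_def card_cartesian_product P mult.commute)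
qed

text \<open>
  If \<open>k\<close> in \<open>P\<close> normalizes \<open>Q\<close>, its commutators with \<open>Q\<close> lie in both \<open>P\<close> and \<open>Q\<close>, hence are
  trivial. So the conjugates of \<open>Q\<close> by the elements of \<open>P\<close> are different.
\<close>

lemma num_conjugates_in_sylow_normalizer:
  assumes fin: "finite (carrier G)" and act: "acts_nontrivially Q P"
    and P: "card P = p" "prime p" and Q: "card Q = q ^ i" "prime q" "q \<noteq> p"
  shows "p \<le> card {Y \<in> conjugates (carrier G) Q. Y \<subseteq> normalizer G P}"
proof -
  have sQ: "subgroup Q G" and sP: "subgroup P G" and QN: "Q \<subseteq> normalizer G P"
    using act by (auto simp: acts_nontrivially_def)
  note PG[simp] = subgroup.mem_carrier[OF sP] and QG[simp] = subgroup.mem_carrier[OF sQ]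
  have PN: "P \<subseteq> normalizer G P" by (rule subgroup_subset_normalizer[OF sP])
  have N: "subgroup (normalizer G P) G" using normalizer_imp_subgroup sP subgroup.subset by blast
  have QS: "Q \<subseteq> carrier G" using sQ subgroup.subset by auto
  have inter: "P \<inter> Q \<subseteq> {\<one>}"
  proof (rule ccontr)
    assume "\<not> P \<inter> Q \<subseteq> {\<one>}"
    then obtain c where c: "c \<in> P" "c \<in> Q" "c \<noteq> \<one>" by auto
    then have "P \<subseteq> Q" using prime_order_subset[OF sP P sQ] by simp
    then have "p dvd q ^ i" using card_subgroup_dvd[OF sP sQ] P Q by simp
    then show False using Q P by (metis prime_dvd_power primes_dvd_imp_eq)
  qed
  have sub: "(\<lambda>h. conjugate h Q) ` P \<subseteq> {Y \<in> conjugates (carrier G) Q. Y \<subseteq> normalizer G P}"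
  proof clarify
    fix h assume h: "h \<in> P"
    have "conjugate h Q \<subseteq> normalizer G P"
    proof -
      have "h \<otimes> x \<otimes> inv h \<in> normalizer G P" if "x \<in> Q" for x
        using h that QN PN N by (meson subgroup.m_closed subgroup.m_inv_closed subsetD)
      then show ?thesis by (auto simp: conjugate_eq_image)
    qed
    then show "conjugate h Q \<in> conjugates (carrier G) Q \<and> conjugate h Q \<subseteq> normalizer G P"
      using h by (auto simp: conjugates_def)
  qed
  have inj: "inj_on (\<lambda>h. conjugate h Q) P"
  proof (rule inj_onI)
    fix h h' assume h: "h \<in> P" "h' \<in> P" and eq: "conjugate h Q = conjugate h' Q"
    let ?k = "inv h' \<otimes> h"
    have k: "?k \<in> P" using h sP by (simp add: subgroup.m_closed subgroup.m_inv_closed)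
    have kQ: "conjugate ?k Q = Q"
      using conjugate_mult[of "inv h'" h Q] conjugate_inv_cancel(1)[of h' Q] eq h QS by simp
    have "x \<otimes> ?k = ?k \<otimes> x" if x: "x \<in> Q" for x
    proof -
      have "?k \<otimes> x \<otimes> inv ?k \<in> Q" using kQ x by (auto simp: conjugate_eq_image)
      then have "?k \<otimes> x \<otimes> inv ?k \<otimes> inv x \<in> Q"
        using x sQ by (simp add: subgroup.m_closed subgroup.m_inv_closed)
      then have "?k \<otimes> x \<otimes> inv ?k \<otimes> inv x = \<one>"
        using acts_nontrivially_commutator[OF act k x] inter by blast
      then show ?thesis using commutator_eq_one_imp[of ?k x] k x by simp
    qed
    then have "?k = \<one>" using acts_nontrivially_no_fixed_point[OF act P k] by simp
    then show "h = h'" using h PG by (metis inv_equality inv_inv inv_closed)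
  qed
  have "finite {Y \<in> conjugates (carrier G) Q. Y \<subseteq> normalizer G P}"
    using fin by (simp add: conjugates_def)
  from card_inj_on_le[OF inj sub this] show ?thesis using P by simp
qed

text \<open>
  Count the pairs of a conjugate \<open>Y\<close> of \<open>Q\<close> and a Sylow subgroup \<open>R\<close> normalized by \<open>Y\<close>. With
  \<open>1 + k p\<close> Sylow subgroups, each \<open>R\<close> occurs at least \<open>p\<close> times and each \<open>Y\<close> at most \<open>1 + k\<close> times. So
  there are at least \<open>p (1 + k p) / (1 + k)\<close> conjugates, and this is smallest for \<open>k = 1\<close>.
\<close>

lemma num_ge_conjugates_of_acting_subgroup:
  assumes fin: "finite (carrier G)" and nd: "\<not> p ^ 2 dvd order G" and act: "acts_nontrivially Q P"
    and P: "card P = p" "prime p" and Q: "card Q = q ^ i" "prime q" "q \<noteq> p"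
    and n1: "num_subgroups p \<noteq> 1"
  shows "p * (p + 1) \<le> 2 * num_subgroups (q ^ i)"
proof -
  let ?S = "{R. subgroup R G \<and> card R = p}" and ?X = "conjugates (carrier G) Q"
  have sQ: "subgroup Q G" and sP: "subgroup P G" using act by (auto simp: acts_nontrivially_def)
  have nd': "\<not> p ^ Suc 1 dvd order G" using nd by (simp add: power2_eq_square)
  have finS: "finite ?S" by (rule finite_subgroups[OF fin])
  have finX: "finite ?X" using fin by (simp add: conjugates_def)
  have S: "?S = conjugates (carrier G) P" using sylow_conjugates[OF fin P(2) nd' sP] P by simp
  have cP: "card (conjugate g P) = p" and cQ: "card (conjugate g Q) = q ^ i" if "g \<in> carrier G" for g
    using card_conjugate[OF that] subgroup.subset[OF sP] subgroup.subset[OF sQ] P Q by simp_all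
  define n where "n = num_subgroups p"
  define k where "k = n div p"
  have n: "n = 1 + k * p"
    using num_sylow_mod[OF fin P(2) nd' sP] P div_mult_mod_eq[of n p] by (simp add: n_def k_def)
  have kpos: "0 < k" using n n1 by (cases k) (auto simp: n_def)
  have "n * p = (\<Sum>R\<in>?S. p)" by (simp add: n_def num_subgroups_def)
  also have "\<dots> \<le> (\<Sum>R\<in>?S. card {Y\<in>?X. Y \<subseteq> normalizer G R})"
  proof (rule sum_mono)
    fix R assume "R \<in> ?S"
    then obtain g where g: "g \<in> carrier G" "R = conjugate g P" using S by (auto simp: conjugates_def)
    have "conjugates (carrier G) (conjugate g Q) = ?X"
    proof -
      have "conjugate h Q \<in> conjugates (carrier G) (conjugate g Q)" if "h \<in> carrier G" for h
      proof -
        have "conjugate h Q = conjugate (h \<otimes> inv g) (conjugate g Q)"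
          using that g conjugate_mult[of "h \<otimes> inv g" g Q] subgroup.subset[OF sQ] by (simp add: m_assoc)
        then show ?thesis using that g unfolding conjugates_def by blast
      qed
      moreover have "conjugate h (conjugate g Q) \<in> ?X" if h: "h \<in> carrier G" for h
      proof -
        have "conjugate h (conjugate g Q) = conjugate (h \<otimes> g) Q"
          by (rule conjugate_mult[OF h g(1) subgroup.subset[OF sQ], symmetric])
        moreover have "h \<otimes> g \<in> carrier G" using h g by simp
        ultimately show ?thesis unfolding conjugates_def by blast
      qed
      ultimately show ?thesis by (auto simp: conjugates_def)
    qed
    then show "p \<le> card {Y\<in>?X. Y \<subseteq> normalizer G R}"
      using num_conjugates_in_sylow_normalizer[OF fin acts_nontrivially_conjugate[OF act g(1)]
          cP[OF g(1)] P(2) cQ[OF g(1)] Q(2,3)] g by simp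
  qed
  also have "\<dots> = (\<Sum>Y\<in>?X. card {R\<in>?S. Y \<subseteq> normalizer G R})"
    by (rule sum_multicount_gen) (use finS finX in auto)
  also have "\<dots> \<le> (\<Sum>Y\<in>?X. 1 + k)"
  proof (rule sum_mono)
    fix Y assume "Y \<in> ?X"
    then obtain g where g: "g \<in> carrier G" "Y = conjugate g Q" by (auto simp: conjugates_def)
    have "p * (card {R\<in>?S. Y \<subseteq> normalizer G R} - 1) \<le> n - 1"
      using num_normalized_sylow_bound[OF fin P(2) nd acts_nontrivially_conjugate[OF act g(1)] cP[OF g(1)]]
      by (simp add: n_def g(2))
    then have "p * (card {R\<in>?S. Y \<subseteq> normalizer G R} - 1) \<le> p * k" using n by (simp add: mult.commute)
    then show "card {R\<in>?S. Y \<subseteq> normalizer G R} \<le> 1 + k" using P by (simp add: prime_gt_0_nat)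
  qed
  also have "\<dots> = card ?X * (1 + k)" by simp
  also have "\<dots> \<le> num_subgroups (q ^ i) * (1 + k)"
  proof -
    have "?X \<subseteq> {H. subgroup H G \<and> card H = q ^ i}"
      using subgroup_conjugate sQ cQ by (auto simp: conjugates_def)
    then show ?thesis
      unfolding num_subgroups_def by (intro mult_right_mono card_mono finite_subgroups fin) auto
  qed
  finally have "2 * (n * p) \<le> 2 * num_subgroups (q ^ i) * (1 + k)" by simp
  \<comment> \<open>Equivalent to \<open>(k - 1) (p - 1) \<ge> 0\<close>.\<close>
  moreover have "(p + 1) * (1 + k) \<le> 2 * n"
  proof -
    obtain k' p' where "k = Suc k'" "p = Suc p'"
      using kpos prime_gt_0_nat[OF P(2)] by (metis gr0_conv_Suc)
    then show ?thesis using n by simp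
  qed
  then have "p * ((p + 1) * (1 + k)) \<le> p * (2 * n)" by (rule mult_le_mono2)
  ultimately have "(p * (p + 1)) * (1 + k) \<le> (2 * num_subgroups (q ^ i)) * (1 + k)"
    by (simp add: algebra_simps)
  then show ?thesis by (metis mult_le_cancel2 zero_less_Suc plus_1_eq_Suc)
qed

end

section \<open>Subgroup numbers of nonabelian simple groups\<close>

locale nonabelian_simple_group = simple_group +
  assumes fin: "finite (carrier G)"
    and nonabelian: "\<exists>x\<in>carrier G. \<exists>y\<in>carrier G. x \<otimes> y \<noteq> y \<otimes> x"
begin

text \<open>
  The action on the conjugates of \<open>H\<close> has a trivial kernel, so it embeds \<open>G\<close> into a symmetric group.
\<close>

lemma order_dvd_fact_num:
  assumes H: "subgroup H G" "H \<noteq> {\<one>}" "H \<noteq> carrier G"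
  shows "order G dvd fact (num_subgroups (card H))"
proof -
  let ?C = "conjugates (carrier G) H"
  let ?\<phi> = "\<lambda>g. \<lambda>R\<in>?C. conjugate g R"
  have HG: "H \<subseteq> carrier G" using H subgroup.subset by auto
  interpret h: group_hom G "BijGroup ?C" ?\<phi>
    by (rule acts_on_BijGroup_hom[OF conjugates_acts_on]) (use subgroup_self H in auto)
  have finC: "finite ?C" using fin by (simp add: conjugates_def)
  have HC: "H \<in> ?C" using conjugate_one[OF HG] by (force simp: conjugates_def)
  have "kernel G (BijGroup ?C) ?\<phi> \<noteq> carrier G"
  proof
    assume k: "kernel G (BijGroup ?C) ?\<phi> = carrier G"
    have fixed: "conjugate g H = H" if "g \<in> carrier G" for g
    proof -
      have "?\<phi> g = (\<lambda>R\<in>?C. R)" using k that by (auto simp: kernel_def BijGroup_def)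
      from fun_cong[OF this, of H] show ?thesis using HC by simp
    qed
    have "g \<otimes> x \<otimes> inv g \<in> H" if "g \<in> carrier G" "x \<in> H" for g x
      using fixed[OF that(1)] that(2) by (auto simp: conjugate_eq_image)
    then have "H \<lhd> G" using normal_inv_iff H by blast
    then show False using no_real_normal_subgroup H by blast
  qed
  then have "inj_on ?\<phi> (carrier G)"
    using h.trivial_ker_imp_inj no_real_normal_subgroup[OF h.normal_kernel] by blast
  then have "order G = card (?\<phi> ` carrier G)" by (simp add: card_image order_def)
  also have "\<dots> dvd card (Bij ?C)"
  proof -
    have "subgroup (?\<phi> ` carrier G) (BijGroup ?C)" by (rule h.img_is_subgroup)
    from group.lagrange[OF group_BijGroup this] have "card (?\<phi> ` carrier G) dvd order (BijGroup ?C)"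
      by (rule dvdI[OF trans[OF sym mult.commute]])
    then show ?thesis by (simp add: order_def BijGroup_def)
  qed
  also have "\<dots> = fact (card ?C)" by (rule card_Bij[OF finC])
  also have "\<dots> dvd fact (num_subgroups (card H))"
  proof (rule fact_dvd)
    have "?C \<subseteq> {K. subgroup K G \<and> card K = card H}"
      using subgroup_conjugate card_conjugate H HG by (auto simp: conjugates_def)
    then show "card ?C \<le> num_subgroups (card H)"
      unfolding num_subgroups_def by (intro card_mono finite_subgroups fin)
  qed
  finally show ?thesis .
qed

text \<open>
  A group of prime power order has a nontrivial center.
\<close>

lemma order_not_prime_power:
  assumes p: "prime p" shows "order G \<noteq> p ^ i"
proof
  assume o: "order G = p ^ i"
  let ?Z = "{z\<in>carrier G. \<forall>g\<in>carrier G. g \<otimes> z \<otimes> inv g = z}"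
  have comm_iff: "g \<otimes> z \<otimes> inv g = z \<longleftrightarrow> g \<otimes> z = z \<otimes> g" if "g \<in> carrier G" "z \<in> carrier G" for g z
    using that by (metis inv_solve_right m_closed)
  have act: "acts_on (carrier G) (carrier G) (\<lambda>g x. g \<otimes> x \<otimes> inv g)"
    using subgroup_self by (auto simp: acts_on_def m_assoc inv_mult_group)
  have cG: "card (carrier G) = p ^ i" using o by (simp add: order_def)
  have "i \<noteq> 0" using o order_gt_one by (cases i) auto
  then have "p dvd card (carrier G)" using cG by simp
  then have "p dvd card ?Z"
    using p_group_fixed_points[OF act cG p fin] by (simp add: dvd_eq_mod_eq_0)
  then have "card ?Z \<noteq> 1" using p by auto
  have Zs: "subgroup ?Z G"
  proof -
    have "?Z = (\<Inter>g\<in>carrier G. {z \<in> carrier G. z \<otimes> g = g \<otimes> z})"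
      using comm_iff by (auto dest: sym)
    then show ?thesis using centralizer_subgroup one_closed
      by (auto intro!: subgroups_Inter)
  qed
  moreover have "g \<otimes> z \<otimes> inv g \<in> ?Z" if "g \<in> carrier G" "z \<in> ?Z" for g z
    using that by auto
  ultimately have "?Z \<lhd> G" using normal_inv_iff by blast
  then have "?Z = carrier G \<or> ?Z = {\<one>}" by (rule no_real_normal_subgroup)
  then show False
  proof
    assume "?Z = carrier G"
    then have "g \<otimes> z = z \<otimes> g" if "g \<in> carrier G" "z \<in> carrier G" for g z
      using that comm_iff by blast
    then show False using nonabelian by blast
  qed (use \<open>card ?Z \<noteq> 1\<close> in simp)
qed

lemma prime_power_subgroup:
  assumes p: "prime p" and d: "p ^ i dvd order G"
  obtains H where "subgroup H G" "card H = p ^ i"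
proof -
  obtain m where "order G = p ^ i * m" using d by (auto elim: dvdE)
  from sylow_thm[OF p is_group this fin] that show ?thesis by blast
qed

lemma order_dvd_fact_num_prime_power:
  assumes p: "prime p" and i: "0 < i" and d: "p ^ i dvd order G"
  shows "order G dvd fact (num_subgroups (p ^ i))"
proof -
  obtain H where H: "subgroup H G" "card H = p ^ i" using prime_power_subgroup[OF p d] .
  have "H \<noteq> {\<one>}" using H one_less_power[OF prime_gt_1_nat[OF p] i] by auto
  moreover have "H \<noteq> carrier G" using H order_not_prime_power[OF p] by (auto simp: order_def)
  ultimately show ?thesis using order_dvd_fact_num[OF H(1)] H(2) by simp
qed

lemma sylow_not_central:
  assumes p: "prime p" and m: "order G = p ^ a * m" "\<not> p dvd m" and a: "0 < a"
    and P: "subgroup P G" "card P = p ^ a"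
  obtains g x where "g \<in> normalizer G P" "x \<in> P" "g \<otimes> x \<noteq> x \<otimes> g"
proof -
  have "\<not> (\<forall>g\<in>normalizer G P. \<forall>x\<in>P. g \<otimes> x = x \<otimes> g)"
  proof
    assume "\<forall>g\<in>normalizer G P. \<forall>x\<in>P. g \<otimes> x = x \<otimes> g"
    then obtain N where N: "N \<lhd> G" "card N = m" using burnside_transfer[OF fin p m P] by blast
    from no_real_normal_subgroup[OF N(1)] show False
    proof
      assume "N = carrier G"
      then have "p ^ a = 1" using N m order_gt_one by (simp add: order_def)
      then show False using a p by (simp add: prime_gt_1_nat)
    next
      assume "N = {\<one>}"
      then show False using N m order_not_prime_power[OF p, of a] by simp
    qed
  qed
  then show ?thesis using that by blast
qed

text \<open>
  A Sylow subgroup of order \<open>p\<close> or \<open>p\<^sup>2\<close> is not its own normalizer, since it is abelian and Burnside's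
  theorem applies. So there are fewer than \<open>m\<close> of them.
\<close>

lemma sylow_numbers:
  assumes p: "prime p" and m: "order G = p ^ a * m" "\<not> p dvd m" and a: "0 < a"
  shows "num_subgroups (p ^ a) mod p = 1" "num_subgroups (p ^ a) dvd m"
    "num_subgroups (p ^ a) \<le> num_subgroups (order G div num_subgroups (p ^ a))"
    "a \<le> 2 \<Longrightarrow> num_subgroups (p ^ a) \<noteq> m"
proof -
  let ?n = "num_subgroups (p ^ a)"
  have nd: "\<not> p ^ Suc a dvd order G" using m p by (simp add: mult.commute prime_gt_0_nat)
  have "p ^ a dvd order G" using m by simp
  then obtain P where P: "subgroup P G" "card P = p ^ a" by (rule prime_power_subgroup[OF p])
  show "?n mod p = 1" by (rule num_sylow_mod[OF fin p nd P])
  show "?n \<le> num_subgroups (order G div ?n)" by (rule num_sylow_le_num_normalizers[OF fin p nd P])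
  have N: "subgroup (normalizer G P) G" using normalizer_imp_subgroup P subgroup.subset by blast
  have PN: "P \<subseteq> normalizer G P" by (rule subgroup_subset_normalizer[OF P(1)])
  have "p ^ a dvd card (normalizer G P)" using card_subgroup_dvd[OF P(1) N PN] P by simp
  then obtain c where c: "card (normalizer G P) = p ^ a * c" by (auto elim: dvdE)
  have "?n * (p ^ a * c) = p ^ a * m" using num_sylow_times_normalizer[OF fin p nd P] c m by simp
  then have nc: "?n * c = m" using p by (simp add: prime_gt_0_nat)
  then show "?n dvd m" by auto
  show "?n \<noteq> m" if "a \<le> 2"
  proof
    assume "?n = m"
    moreover have "m \<noteq> 0" using m(2) by (cases m) auto
    ultimately have "c = 1" using nc by simp
    then have "normalizer G P = P"
      using card_subset_eq[OF _ PN] c P finite_subset[OF subgroup.subset[OF N] fin] by simp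
    then show False
      using sylow_not_central[OF p m a P] abelian_of_order_dvd_prime_square[OF P p a that] by metis
  qed
qed

text \<open>
  The acting subgroup is a Sylow \<open>q\<close>-subgroup \<open>Q\<close> of the normalizer of a Sylow subgroup \<open>P\<close> of order \<open>p\<close>, for
  a prime \<open>q\<close> that divides the index of the centralizer. It acts without fixed points
  on the \<open>p - 1\<close> nontrivial elements of \<open>P\<close>, so \<open>q\<close> divides \<open>p - 1\<close>.
\<close>

lemma nontrivially_acting_prime_power:
  assumes p: "prime p" and m: "order G = p * m" "\<not> p dvd m"
  obtains q i where "prime q" "q dvd p - 1" "0 < i" "q ^ i dvd order G"
    "q dvd order G div num_subgroups p" "p * (p + 1) \<le> 2 * num_subgroups (q ^ i)"
proof -
  have nd: "\<not> p ^ 2 dvd order G" using m p by (simp add: power2_eq_square prime_gt_0_nat)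
  then have nd1: "\<not> p ^ Suc 1 dvd order G" by (simp add: power2_eq_square)
  have m1: "order G = p ^ 1 * m" using m by simp
  obtain P where P: "subgroup P G" "card P = p" using prime_power_subgroup[OF p, of 1] m by auto
  have P1: "card P = p ^ 1" using P by simp
  have PG: "P \<subseteq> carrier G" using P subgroup.subset by auto
  have N: "subgroup (normalizer G P) G" using normalizer_imp_subgroup PG by blast
  have finN: "finite (normalizer G P)" using finite_subset[OF subgroup.subset[OF N] fin] .
  have PN: "P \<subseteq> normalizer G P" by (rule subgroup_subset_normalizer[OF P(1)])
  have nN: "num_subgroups p * card (normalizer G P) = order G"
    using num_sylow_times_normalizer[OF fin p nd1 P(1) P1] by simp
  obtain g x where gx: "g \<in> normalizer G P" "x \<in> P" "g \<otimes> x \<noteq> x \<otimes> g"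
    using sylow_not_central[OF p m1 m(2) _ P(1) P1] by auto
  let ?C = "normalizer G P \<inter> {g \<in> carrier G. g \<otimes> x = x \<otimes> g}"
  have xG: "x \<in> carrier G" using gx PG by auto
  have C: "subgroup ?C G" by (rule subgroups_Inter_pair[OF N centralizer_subgroup[OF xG]])
  have PC: "P \<subseteq> ?C"
    using PN abelian_of_order_dvd_prime_square[OF P(1) P1 p _ _ _ gx(2)] PG by auto
  have "card ?C < card (normalizer G P)"
    using gx by (intro psubset_card_mono finN) auto
  moreover have Cpos: "0 < card ?C" using C finN subgroup.one_closed by (fastforce simp: card_gt_0_iff)
  ultimately have "\<not> card (normalizer G P) dvd card ?C" by (meson dvd_imp_le not_le)
  moreover have Npos: "card (normalizer G P) \<noteq> 0" using finN gx(1) by auto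
  ultimately obtain q where q: "prime q" "multiplicity q (card ?C) < multiplicity q (card (normalizer G P))"
    using multiplicity_le_imp_dvd[OF Npos] by (meson not_le)
  define i where "i = multiplicity q (card (normalizer G P))"
  have i0: "0 < i" using q by (simp add: i_def)
  have qN: "q ^ i dvd card (normalizer G P)" by (simp add: i_def multiplicity_dvd)
  have qC: "\<not> q ^ i dvd card ?C"
    using q Cpos power_dvd_iff_le_multiplicity[of "card ?C" q i] prime_gt_1_nat[OF q(1)]
    by (auto simp: i_def)
  \<comment> \<open>A Sylow \<open>q\<close>-subgroup of the normalizer is too large for the centralizer.\<close>
  obtain Q where Q: "subgroup Q G" "Q \<subseteq> normalizer G P" "card Q = q ^ i"
  proof -
    obtain c where "order (G\<lparr>carrier := normalizer G P\<rparr>) = q ^ i * c"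
      using qN by (auto simp: order_def elim: dvdE)
    from sylow_thm[OF q(1) subgroup_imp_group[OF N] this] finN obtain Q
      where "subgroup Q (G\<lparr>carrier := normalizer G P\<rparr>)" "card Q = q ^ i" by auto
    then show ?thesis using that incl_subgroup[OF N] subgroup.subset by fastforce
  qed
  have "\<not> Q \<subseteq> ?C" using card_subgroup_dvd[OF Q(1) C] qC Q by auto
  then have act: "acts_nontrivially Q P"
    using Q P gx subgroup.mem_carrier[OF Q(1)] unfolding acts_nontrivially_def by blast
  have qp: "q \<noteq> p"
  proof
    assume [simp]: "q = p"
    have "p dvd card ?C" using card_subgroup_dvd[OF P(1) C PC] P by simp
    then have "1 < i" using q Cpos i0 qC by (cases i; cases "i - 1") auto
    then have "p ^ 2 dvd card (normalizer G P)" using qN by (metis dvd_trans le_imp_power_dvd Suc_leI one_add_one plus_1_eq_Suc \<open>q = p\<close>)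
    then show False using nd nN by (metis dvd_mult)
  qed
  have "q dvd p - 1"
  proof -
    let ?E = "P - {\<one>}"
    have act': "acts_on Q ?E (\<lambda>g x. g \<otimes> x \<otimes> inv g)"
      unfolding acts_on_def
    proof (intro conjI ballI)
      show "subgroup Q G" by (rule Q(1))
      fix g x assume g: "g \<in> Q" and x: "x \<in> ?E"
      have gG: "g \<in> carrier G" and xG: "x \<in> carrier G" and xP: "x \<in> P"
        using subgroup.mem_carrier[OF Q(1) g] x PG by auto
      have "g \<otimes> x \<otimes> inv g \<noteq> \<one>"
      proof
        assume "g \<otimes> x \<otimes> inv g = \<one>"
        then have "g \<otimes> x = g" using gG xG by (simp add: inv_solve_right')
        then show False using gG xG x by simp
      qed
      then show "g \<otimes> x \<otimes> inv g \<in> ?E" using normalizer_conj_closed[OF PG subsetD[OF Q(2) g] xP] by simp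
      fix h assume "h \<in> Q"
      then have "h \<in> carrier G" using subgroup.mem_carrier[OF Q(1)] by simp
      then show "g \<otimes> h \<otimes> x \<otimes> inv (g \<otimes> h) = g \<otimes> (h \<otimes> x \<otimes> inv h) \<otimes> inv g"
        using gG xG by (simp add: m_assoc inv_mult_group)
    qed (use PG in auto)
    have none: "{x\<in>?E. \<forall>g\<in>Q. g \<otimes> x \<otimes> inv g = x} = {}"
    proof (rule ccontr)
      assume "{x\<in>?E. \<forall>g\<in>Q. g \<otimes> x \<otimes> inv g = x} \<noteq> {}"
      then obtain h where h: "h \<in> P" "h \<noteq> \<one>" "\<And>g. g \<in> Q \<Longrightarrow> g \<otimes> h \<otimes> inv g = h" by auto
      have "g \<otimes> h = h \<otimes> g" if "g \<in> Q" for g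
        using h(3)[OF that] h(1) that PG subgroup.mem_carrier[OF Q(1) that]
        by (metis inv_solve_right m_closed subsetD)
      then show False using acts_nontrivially_no_fixed_point[OF act P(2) p h(1)] h(2) by simp
    qed
    have "finite ?E" using finite_subset[OF PG fin] by simp
    from p_group_fixed_points[OF act' Q(3) q(1) this] have "card ?E mod q = 0"
      unfolding none by simp
    moreover have "card ?E = p - 1" using P subgroup.one_closed[OF P(1)] by (simp add: card_Diff_singleton)
    ultimately show ?thesis by (simp add: dvd_eq_mod_eq_0)
  qed
  moreover have "q ^ i dvd order G" using qN nN by (metis dvd_mult)
  moreover have "q dvd order G div num_subgroups p"
  proof -
    have "num_subgroups p \<noteq> 0" using nN order_gt_one by (metis mult_0 not_less_zero)
    then have "order G div num_subgroups p = card (normalizer G P)" using nN by (metis nonzero_mult_div_cancel_left)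
    then show ?thesis using qN i0 by (metis dvd_power dvd_trans)
  qed
  moreover have "p * (p + 1) \<le> 2 * num_subgroups (q ^ i)"
  proof (rule num_ge_conjugates_of_acting_subgroup[OF fin nd act P(2) p Q(3) q(1) qp])
    have "order G dvd fact (num_subgroups (p ^ 1))"
      by (rule order_dvd_fact_num_prime_power[OF p]) (use m in auto)
    then show "num_subgroups p \<noteq> 1" using order_gt_one by auto
  qed
  ultimately show ?thesis using that q i0 by blast
qed

end

text \<open>
  No positive number below \<open>p\<^sup>2\<close> has more than one factor \<open>p\<close>, so only the multiples of \<open>p\<close> are counted.
\<close>

lemma multiplicity_fact_lt_square:
  assumes p: "prime (p::nat)" and k: "k < p\<^sup>2"
  shows "multiplicity p (fact k) = k div p"
  using k
proof (induction k)
  case (Suc k)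
  have "multiplicity p (fact (Suc k)) = multiplicity p (Suc k * fact k)" by simp
  also have "\<dots> = multiplicity p (Suc k) + multiplicity p (fact k)"
    by (rule prime_elem_multiplicity_mult_distrib) (use p in auto)
  also have "multiplicity p (Suc k) = (if p dvd Suc k then 1 else 0)"
  proof (cases "p dvd Suc k")
    case True
    have "\<not> p ^ Suc 1 dvd Suc k" using Suc.prems by (auto simp: power2_eq_square dest: dvd_imp_le)
    then show ?thesis using True by (intro multiplicity_eqI) auto
  qed (simp add: not_dvd_imp_multiplicity_0)
  finally show ?case using Suc by (simp add: div_Suc mod_eq_0_iff_dvd)
qed simp

lemma prime_power_dvd_fact_imp_le:
  assumes p: "prime (p::nat)" and d: "p ^ j dvd fact k" and j: "j \<le> p"
  shows "j * p \<le> k"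
proof (cases "k < p\<^sup>2")
  case True
  have "j \<le> multiplicity p (fact k :: nat)"
    using d p by (intro multiplicity_geI) auto
  then have "j \<le> k div p" using multiplicity_fact_lt_square[OF p True] by simp
  then show ?thesis using prime_gt_0_nat[OF p] by (simp add: less_eq_div_iff_mult_less_eq)
next
  case False
  show ?thesis
    by (rule order_trans[OF mult_le_mono1[OF j]]) (use False in \<open>simp add: power2_eq_square\<close>)
qed

lemma prime_powers_distinct:
  assumes "prime (p::nat)" "prime q" "p \<noteq> q" "0 < i"
  shows "p ^ i \<noteq> q ^ j"
proof
  assume "p ^ i = q ^ j"
  then have "p dvd q ^ j" using assms(4) by (metis dvd_power)
  then show False using assms by (metis prime_dvd_power primes_dvd_imp_eq)
qed

lemma prime_power_times_coprime_neq:
  assumes p: "prime (p::nat)" and c: "\<not> p dvd c" "c \<noteq> 1"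
  shows "p ^ a * c \<noteq> p ^ j"
proof
  assume "p ^ a * c = p ^ j"
  then obtain i where "c = p ^ i" using divides_primepow_nat[OF p] by (metis dvd_triv_right)
  then show False using c by (cases i) auto
qed

lemma prime_dvd_neq_prime_power:
  assumes "prime (p::nat)" "prime q" "p \<noteq> q" "p dvd d"
  shows "d \<noteq> q ^ j"
  using assms by (metis prime_dvd_power primes_dvd_imp_eq)

context nonabelian_simple_group
begin

lemma order_le_fact_num:
  assumes "prime p" "0 < i" "p ^ i dvd order G" "num_subgroups (p ^ i) \<le> k"
  shows "order G \<le> fact k"
proof -
  have "order G \<le> fact (num_subgroups (p ^ i))"
    using order_dvd_fact_num_prime_power[OF assms(1-3)] by (simp add: dvd_imp_le)
  also have "\<dots> \<le> fact k" using assms(4) by (rule fact_mono)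
  finally show ?thesis .
qed

text \<open>
  Orders that are not prime powers are left, namely 6, 12 and 24. In each case Sylow's theorem gives
  a nontrivial action on at most three points, and on at most two if the order is 6, which is too few
  for a faithful action.
\<close>

lemma order_not_dvd_24: "\<not> order G dvd 24"
proof
  assume d: "order G dvd 24"
  then obtain k where k: "24 = order G * k" by (rule dvdE)
  have "prime (2::nat)" "prime (3::nat)" by simp_all
  then have np: "order G \<noteq> 2 ^ 1" "order G \<noteq> 3 ^ 1" "order G \<noteq> 2 ^ 2" "order G \<noteq> 2 ^ 3"
    using order_not_prime_power by blast+
  then have "5 \<le> order G" using order_gt_one by auto
  then have "k < 5" using k mult_le_mono[of 5 "order G" 5 k] by linarith
  then have "k \<in> {0, 1, 2, 3, 4}" by auto
  then consider "order G = 6" | "order G = 12" | "order G = 24" using k np by auto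
  then show False
  proof cases
    case 1
    then have "num_subgroups (3 ^ 1) dvd 2" by (intro sylow_numbers) auto
    then have "num_subgroups (3 ^ 1) \<le> 2" by (rule dvd_imp_le) simp
    then show False using order_le_fact_num[of 3 1 2] 1 by simp
  next
    case 2
    then have "num_subgroups (2 ^ 2) dvd 3" by (intro sylow_numbers) auto
    then have "num_subgroups (2 ^ 2) \<le> 3" by (rule dvd_imp_le) simp
    then show False using order_le_fact_num[of 2 2 3] 2 by (simp add: fact_numeral)
  next
    case 3
    then have "num_subgroups (2 ^ 3) dvd 3" by (intro sylow_numbers) auto
    then have "num_subgroups (2 ^ 3) \<le> 3" by (rule dvd_imp_le) simp
    then show False using order_le_fact_num[of 2 3 3] 3 by (simp add: fact_numeral)
  qed
qed

lemma num_ge_5: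
  assumes "prime p" "0 < i" "p ^ i dvd order G"
  shows "5 \<le> num_subgroups (p ^ i)"
proof (rule ccontr)
  assume "\<not> 5 \<le> num_subgroups (p ^ i)"
  then have "fact (num_subgroups (p ^ i)) dvd (fact 4 :: nat)" by (intro fact_dvd) simp
  then have "order G dvd fact 4"
    using order_dvd_fact_num_prime_power[OF assms] dvd_trans by blast
  then show False using order_not_dvd_24 by (simp add: fact_numeral)
qed

lemma num_ge_multiple:
  assumes "prime r" "0 < i" "r ^ i dvd order G" "prime p" "p ^ j dvd order G" "j \<le> p"
  shows "j * p \<le> num_subgroups (r ^ i)"
  using prime_power_dvd_fact_imp_le[OF assms(4) _ assms(6)]
    order_dvd_fact_num_prime_power[OF assms(1-3)] assms(5) dvd_trans by blast

text \<open>
  The numbers \<open>c\<close> and \<open>p\<^sup>a c\<close> are the index of a Sylow subgroup in its normalizer and the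
  order of this normalizer.
\<close>

lemma sylow_normalizer_order:
  assumes p: "prime p" and m: "order G = p ^ a * m" "\<not> p dvd m" and a: "0 < a"
  obtains c where "m = num_subgroups (p ^ a) * c" "\<not> p dvd c" "a \<le> 2 \<Longrightarrow> c \<noteq> 1"
    "p ^ a * c \<noteq> order G" "num_subgroups (p ^ a) \<le> num_subgroups (p ^ a * c)"
    "num_subgroups (p ^ a) mod p = 1" "5 \<le> num_subgroups (p ^ a)"
proof -
  let ?n = "num_subgroups (p ^ a)"
  note s = sylow_numbers[OF p m a]
  obtain c where c: "m = ?n * c" using s(2) by (auto elim: dvdE)
  have n5: "5 \<le> ?n" using num_ge_5[OF p a] m by simp
  have o: "order G = ?n * (p ^ a * c)" using m c by simp
  then have "order G div ?n = p ^ a * c" using n5 by simp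
  then have "?n \<le> num_subgroups (p ^ a * c)" using s(3) by simp
  moreover have "p ^ a * c \<noteq> order G"
  proof
    assume "p ^ a * c = order G"
    then have "order G = ?n * order G" using o by simp
    then show False using n5 order_gt_one by simp
  qed
  moreover have "\<not> p dvd c" using c m(2) by auto
  moreover have "c \<noteq> 1" if "a \<le> 2" using s(4)[OF that] c by auto
  ultimately show ?thesis using that[OF c] s(1) n5 by blast
qed

lemma order_decompose:
  assumes p: "prime p" "p ^ k dvd order G"
  obtains a m where "order G = p ^ a * m" "\<not> p dvd m" "k \<le> a"
proof -
  have o: "order G \<noteq> 0" using order_gt_one by simp
  obtain m where m: "order G = p ^ multiplicity p (order G) * m" "\<not> p dvd m"
    using multiplicity_decompose'[OF o, of p] p(1) not_prime_unit by blast
  moreover have "k \<le> multiplicity p (order G)"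
    using p o by (intro multiplicity_geI) auto
  ultimately show ?thesis using that by blast
qed

lemma other_prime_divisor:
  assumes p: "prime p"
  obtains q where "prime q" "q \<noteq> p" "q dvd order G"
proof -
  obtain a m where m: "order G = p ^ a * m" "\<not> p dvd m" using order_decompose[OF p, of 0] by auto
  have "m \<noteq> 1" using m order_not_prime_power[OF p, of a] by auto
  then obtain q where "prime q" "q dvd m" using prime_factor_nat by blast
  then show ?thesis by (intro that[of q]) (use m in auto)
qed

end

section \<open>Excluding prime divisors by counting\<close>

text \<open>
  The assumptions of this locale are contradictory, which is what the lemmas in it establish step by
  step.
\<close>

locale few_subgroups = nonabelian_simple_group +
  assumes few: "Sub G < 59"
begin

lemma sum_num_le:
  assumes "distinct ds" "1 \<notin> set ds" "order G \<notin> set ds"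
  shows "sum_list (map num_subgroups ds) \<le> 56"
  using sum_num_subgroups_le_Sub[OF fin, of "set ds"] assms order_gt_one few
  by (simp add: sum_list_distinct_conv_sum_set)

text \<open>
  All powers of two that divide \<open>|G|\<close> contribute at least 5 each. One of them, \<open>2\<^sup>i\<close>, may be known to
  contribute more; at least \<open>k - 1\<close> of the exponents \<open>1, \<dots>, k\<close> differ from \<open>i\<close>.
\<close>

lemma sum_num_with_two_powers_le:
  assumes ds: "distinct ds" "order G \<notin> set ds" "\<And>d j. d \<in> set ds \<Longrightarrow> d \<noteq> 2 ^ j"
    and i: "0 < i" "2 ^ i dvd order G" and k: "2 ^ k dvd order G"
  shows "sum_list (map num_subgroups ds) + num_subgroups (2 ^ i) + 5 * (k - 1) \<le> 56"
proof -
  let ?J = "insert i {1..k}" and ?e = "\<lambda>j. 2 ^ j :: nat"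
  have dvdJ: "0 < j \<and> 2 ^ j dvd order G" if "j \<in> ?J" for j
    using that i k by (auto intro: dvd_trans le_imp_power_dvd)
  have inj: "inj_on ?e ?J" by (auto simp: inj_on_def)
  let ?D = "set ds \<union> ?e ` ?J"
  have disj: "set ds \<inter> ?e ` ?J = {}" using ds(3) by blast
  have "2 + (\<Sum>d\<in>?D. num_subgroups d) \<le> Sub G"
  proof (rule sum_num_subgroups_le_Sub[OF fin])
    have "1 \<notin> set ds" using ds(3)[of 1 0] by auto
    moreover have "1 \<notin> ?e ` ?J"
    proof
      assume "1 \<in> ?e ` ?J"
      then obtain j where "j \<in> ?J" "1 = ?e j" by (rule imageE)
      then show False using dvdJ[of j] one_less_power[of "2::nat" j] by simp
    qed
    ultimately show "1 \<notin> ?D" by blast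
    show "order G \<notin> ?D" using ds(2) order_not_prime_power[of 2] by auto
  qed (use order_gt_one in auto)
  moreover have "(\<Sum>d\<in>?D. num_subgroups d) = (\<Sum>d\<in>set ds. num_subgroups d) + (\<Sum>j\<in>?J. num_subgroups (2 ^ j))"
  proof -
    have "(\<Sum>d\<in>?e ` ?J. num_subgroups d) = (\<Sum>j\<in>?J. num_subgroups (2 ^ j))"
      using sum.reindex[OF inj, of num_subgroups] by (simp only: o_def)
    moreover have "(\<Sum>d\<in>?D. num_subgroups d) = (\<Sum>d\<in>set ds. num_subgroups d) + (\<Sum>d\<in>?e ` ?J. num_subgroups d)"
      by (rule sum.union_disjoint[OF _ _ disj]) auto
    ultimately show ?thesis by simp
  qed
  moreover have "num_subgroups (2 ^ i) + 5 * (k - 1) \<le> (\<Sum>j\<in>?J. num_subgroups (2 ^ j))"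
  proof -
    have "card {1..k} \<le> card (insert i (?J - {i}))" by (rule card_mono) auto
    also have "\<dots> \<le> Suc (card (?J - {i}))" by (rule card_insert_le_m1) auto
    finally have "5 * (k - 1) \<le> card (?J - {i}) * 5" by simp
    also have "\<dots> \<le> (\<Sum>j\<in>?J - {i}. num_subgroups (2 ^ j))"
      using sum_bounded_below[of "?J - {i}" "5::nat" "\<lambda>j. num_subgroups (2 ^ j)"] num_ge_5[of 2] dvdJ
      by auto
    finally show ?thesis by (subst sum.remove[of _ i]) auto
  qed
  ultimately show ?thesis using few ds(1) by (simp add: sum_list_distinct_conv_sum_set)
qed

text \<open>
  If \<open>p\<^sup>3\<close> divided \<open>|G|\<close>, the orders \<open>p\<close>, \<open>p\<^sup>2\<close>, \<open>p\<^sup>3\<close> and another prime would contribute at least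
  \<open>3 p\<close> each, which is more than 56 in total. So the Sylow \<open>p\<close>-subgroups have order \<open>p\<^sup>2\<close>; their number is at
  least \<open>2 p\<close> and is \<open>1\<close> modulo \<open>p\<close>.
\<close>

lemma square_divisor_sylow:
  assumes p: "prime p" "5 \<le> p" "p ^ 2 dvd order G"
  obtains c where "order G = p ^ 2 * (num_subgroups (p ^ 2) * c)" "\<not> p dvd c" "c \<noteq> 1"
    "p ^ 2 * c \<noteq> order G" "num_subgroups (p ^ 2) \<le> num_subgroups (p ^ 2 * c)"
    "num_subgroups (p ^ 2) mod p = 1" "2 * p + 1 \<le> num_subgroups (p ^ 2)"
proof -
  obtain q where q: "prime q" "q \<noteq> p" "q dvd order G" using other_prime_divisor[OF p(1)] .
  have neq: "order G \<noteq> r ^ i" if "prime r" for r i using order_not_prime_power[OF that] .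
  have "\<not> p ^ 3 dvd order G"
  proof
    assume p3: "p ^ 3 dvd order G"
    then have pj: "p ^ 1 dvd order G" using p dvd_trans by (metis le_imp_power_dvd one_le_numeral)
    have "sum_list (map num_subgroups [p ^ 1, p ^ 2, p ^ 3, q ^ 1]) \<le> 56"
    proof (rule sum_num_le)
      show "distinct [p ^ 1, p ^ 2, p ^ 3, q ^ 1]"
        using prime_powers_distinct[OF p(1) q(1) q(2)[symmetric], of 1 1]
          prime_powers_distinct[OF p(1) q(1) q(2)[symmetric], of 2 1]
          prime_powers_distinct[OF p(1) q(1) q(2)[symmetric], of 3 1] prime_gt_1_nat[OF p(1)]
          power_inject_exp[of p 1 2] power_inject_exp[of p 1 3] power_inject_exp[of p 2 3]
        by simp
      show "1 \<notin> set [p ^ 1, p ^ 2, p ^ 3, q ^ 1]"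
        using prime_gt_1_nat[OF p(1)] prime_gt_1_nat[OF q(1)]
          one_less_power[OF prime_gt_1_nat[OF p(1)], of 2] one_less_power[OF prime_gt_1_nat[OF p(1)], of 3]
        by simp
      show "order G \<notin> set [p ^ 1, p ^ 2, p ^ 3, q ^ 1]" using neq[OF p(1), of 1] neq[OF p(1), of 2] neq[OF p(1), of 3] neq[OF q(1), of 1] by simp
    qed
    moreover have ge: "3 * p \<le> num_subgroups (r ^ i)" if "prime r" "0 < i" "r ^ i dvd order G" for r i
      using num_ge_multiple[OF that p(1) p3] p by simp
    have "3 * p \<le> num_subgroups (p ^ 1)" "3 * p \<le> num_subgroups (p ^ 2)"
      "3 * p \<le> num_subgroups (p ^ 3)" "3 * p \<le> num_subgroups (q ^ 1)"
      using ge[OF p(1) _ pj] ge[OF p(1) _ p(3)] ge[OF p(1) _ p3] ge[OF q(1), of 1] q(3) by simp_all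
    ultimately show False using p by simp
  qed
  then obtain m where m: "order G = p ^ 2 * m" "\<not> p dvd m"
    using p(3) by (auto simp: power3_eq_cube power2_eq_square elim!: dvdE)
  obtain c where c: "m = num_subgroups (p ^ 2) * c" "\<not> p dvd c" "c \<noteq> 1"
    "p ^ 2 * c \<noteq> order G" "num_subgroups (p ^ 2) \<le> num_subgroups (p ^ 2 * c)"
    "num_subgroups (p ^ 2) mod p = 1"
    using sylow_normalizer_order[OF p(1) m] by (metis order_refl pos2)
  have "2 * p \<le> num_subgroups (p ^ 2)" using num_ge_multiple[OF p(1) _ p(3) p(1) p(3)] p by simp
  moreover have "num_subgroups (p ^ 2) \<noteq> 2 * p" using c(6) by auto
  ultimately have "2 * p + 1 \<le> num_subgroups (p ^ 2)" by simp
  then show ?thesis using that m c by metis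
qed

text \<open>
  The Sylow subgroups and their normalizers contribute \<open>2 (2 p + 1)\<close>, subgroups of order \<open>p\<close> and of
  another prime order contribute \<open>4 p\<close>, and \<open>8 p + 2 \<ge> 58\<close>.
\<close>

lemma no_square_of_prime_ge_7:
  assumes p: "prime p" "7 \<le> p" shows "\<not> p ^ 2 dvd order G"
proof
  assume sq: "p ^ 2 dvd order G"
  have "5 \<le> p" using p by simp
  obtain c where c: "\<not> p dvd c" "c \<noteq> 1" "p ^ 2 * c \<noteq> order G"
    "num_subgroups (p ^ 2) \<le> num_subgroups (p ^ 2 * c)" "2 * p + 1 \<le> num_subgroups (p ^ 2)"
    using square_divisor_sylow[OF p(1) \<open>5 \<le> p\<close> sq] by metis
  obtain q where q: "prime q" "q \<noteq> p" "q dvd order G" using other_prime_divisor[OF p(1)] .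
  have pd: "p ^ 1 dvd order G" using sq by (metis dvd_trans le_imp_power_dvd one_le_numeral)
  note neq = order_not_prime_power[OF p(1)] order_not_prime_power[OF q(1)]
  have "sum_list (map num_subgroups [p ^ 1, p ^ 2, p ^ 2 * c, q ^ 1]) \<le> 56"
  proof (rule sum_num_le)
    have "p ^ 2 * c \<noteq> q ^ 1"
      by (rule prime_dvd_neq_prime_power[OF p(1) q(1) q(2)[symmetric]]) (simp add: power2_eq_square)
    then show "distinct [p ^ 1, p ^ 2, p ^ 2 * c, q ^ 1]"
      using prime_powers_distinct[OF p(1) q(1) q(2)[symmetric], of 1 1]
        prime_powers_distinct[OF p(1) q(1) q(2)[symmetric], of 2 1]
        prime_power_times_coprime_neq[OF p(1) c(1,2), of 2 1]
        prime_power_times_coprime_neq[OF p(1) c(1,2), of 2 2]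
        power_inject_exp[of p 1 2] p by auto
    show "1 \<notin> set [p ^ 1, p ^ 2, p ^ 2 * c, q ^ 1]"
      using p prime_gt_1_nat[OF q(1)] one_less_power[of p 2]
        prime_power_times_coprime_neq[OF p(1) c(1,2), of 2 0] by auto
    show "order G \<notin> set [p ^ 1, p ^ 2, p ^ 2 * c, q ^ 1]"
      using neq(1)[of 1] neq(1)[of 2] neq(2)[of 1] c(3) by auto
  qed
  moreover have "2 * p \<le> num_subgroups (p ^ 1)"
    by (rule num_ge_multiple[OF p(1) _ pd p(1) sq]) (use p in auto)
  moreover have "2 * p \<le> num_subgroups (q ^ 1)"
    by (rule num_ge_multiple[OF q(1) _ _ p(1) sq]) (use p q in auto)
  ultimately show False using c(4,5) p(2) by simp
qed

text \<open>
  The conjugates of an acting subgroup alone are at least \<open>11 \<cdot> 12 / 2 = 66\<close>.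
\<close>

lemma no_prime_ge_11:
  assumes p: "prime p" "11 \<le> p" shows "\<not> p dvd order G"
proof
  assume d: "p dvd order G"
  then obtain m where m: "order G = p * m" by (auto elim: dvdE)
  have "\<not> p dvd m" using no_square_of_prime_ge_7[of p] p m by (auto simp: power2_eq_square)
  then obtain q i where q: "prime q" "0 < i" "p * (p + 1) \<le> 2 * num_subgroups (q ^ i)"
    using nontrivially_acting_prime_power[OF p(1) m] by metis
  have "sum_list (map num_subgroups [q ^ i]) \<le> 56"
    using order_not_prime_power[OF q(1), of i] one_less_power[OF prime_gt_1_nat[OF q(1)] q(2)]
    by (intro sum_num_le) auto
  then have "p * (p + 1) \<le> 112" using q by simp
  moreover have "11 * 12 \<le> p * (p + 1)" using p by (intro mult_le_mono) auto
  ultimately show False by simp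
qed

text \<open>
  Each prime power dividing \<open>|G|\<close> is the order of at least 10 subgroups, and there are 11 or 16 Sylow
  subgroups. In the first case 11 divides
  \<open>|G|\<close>; in the second 16 does, which yields subgroups of orders 2 and 4.
\<close>

lemma not_25_dvd_order: "\<not> 5 ^ 2 dvd order G"
proof
  assume sq: "5 ^ 2 dvd order G"
  have p5: "prime (5::nat)" by simp
  define n where "n = num_subgroups (5 ^ 2)"
  obtain c where c: "order G = 5 ^ 2 * (n * c)" "\<not> 5 dvd c" "c \<noteq> 1" "5 ^ 2 * c \<noteq> order G"
    "n \<le> num_subgroups (5 ^ 2 * c)" "n mod 5 = 1" "2 * 5 + 1 \<le> n"
    using square_divisor_sylow[OF p5 _ sq] unfolding n_def by auto
  have neq: "5 ^ 2 * c \<noteq> q ^ j" if "prime q" for q j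
  proof (cases "q = 5")
    case False
    have "5 dvd 5 ^ 2 * c" by (rule dvd_mult2) simp
    then show ?thesis using prime_dvd_neq_prime_power[OF p5 that] False by auto
  qed (use prime_power_times_coprime_neq[OF p5 c(2,3)] in blast)
  have oneq: "order G \<noteq> q ^ j" if "prime q" for q j using order_not_prime_power[OF that] .
  obtain q where q: "prime q" "q \<noteq> 5" "q dvd order G" using other_prime_divisor[OF p5] .
  have ten: "10 \<le> num_subgroups (r ^ i)" if "prime r" "0 < i" "r ^ i dvd order G" for r i
    using num_ge_multiple[OF that p5 sq] by simp
  have "5 ^ 1 dvd order G" using sq by (metis dvd_trans le_imp_power_dvd one_le_numeral)
  have "sum_list (map num_subgroups [5 ^ 1, 5 ^ 2, 5 ^ 2 * c, q ^ 1]) \<le> 56"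
    using neq[OF p5, of 1] neq[OF p5, of 2] neq[OF p5, of 0] neq[OF q(1), of 1] q(2)
      prime_powers_distinct[OF p5 q(1) q(2)[symmetric], of 2 1] prime_gt_1_nat[OF q(1)]
      oneq[OF p5, of 1] oneq[OF p5, of 2] oneq[OF q(1), of 1] c(4)
    by (intro sum_num_le) auto
  moreover have "10 \<le> num_subgroups (5 ^ 1)" "10 \<le> num_subgroups (q ^ 1)"
    using ten[OF p5, of 1] ten[OF q(1), of 1] \<open>5 ^ 1 dvd order G\<close> q by simp_all
  ultimately have "n \<le> 18" using c(5) by (simp add: n_def)
  then have "n = 11 \<or> n = 16" using c(6,7) by presburger
  then show False
  proof
    assume "n = 11"
    then show False using no_prime_ge_11[of 11] c(1) by simp
  next
    assume n: "n = 16"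
    then have two: "2 ^ 1 dvd order G" "2 ^ 2 dvd order G"
      using c(1) by (auto intro: dvd_trans[of _ 16])
    have p2: "prime (2::nat)" by simp
    have "sum_list (map num_subgroups [5 ^ 1, 5 ^ 2, 5 ^ 2 * c, 2 ^ 1, 2 ^ 2]) \<le> 56"
      using neq[OF p5, of 1] neq[OF p5, of 2] neq[OF p5, of 0] neq[OF p2, of 1] neq[OF p2, of 2]
        oneq[OF p5, of 1] oneq[OF p5, of 2] oneq[OF p2, of 1] oneq[OF p2, of 2] c(4)
      by (intro sum_num_le) auto
    then show False
      using ten[OF p5, of 1] ten[OF p2 _ two(1)] ten[OF p2 _ two(2)] \<open>5 ^ 1 dvd order G\<close> c(5) n
      by (simp add: n_def)
  qed
qed

text \<open>
  The acting subgroup has at least 28 conjugates, which leaves room for 8 Sylow subgroups and 8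
  normalizers only. Then 8 divides \<open>|G|\<close> (16 does if the acting subgroup is a 2-group), and there are at
  least three further orders of 2-groups.
\<close>

lemma not_7_dvd_order: "\<not> 7 dvd order G"
proof
  assume "7 dvd order G"
  then obtain m where m: "order G = 7 * m" by (auto elim: dvdE)
  have p7: "prime (7::nat)" and p2: "prime (2::nat)" by simp_all
  have m7: "\<not> 7 dvd m" using no_square_of_prime_ge_7[of 7] m by (auto simp: power2_eq_square)
  define n where "n = num_subgroups (7 ^ 1)"
  obtain c where c: "m = n * c" "\<not> 7 dvd c" "c \<noteq> 1" "7 ^ 1 * c \<noteq> order G"
    "n \<le> num_subgroups (7 ^ 1 * c)" "n mod 7 = 1" "5 \<le> n"
    using sylow_normalizer_order[OF p7, of 1 m] m m7 unfolding n_def by auto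
  obtain q i where q: "prime q" "q dvd 7 - 1" "0 < i" "q ^ i dvd order G"
    "q dvd order G div num_subgroups 7" "7 * (7 + 1) \<le> 2 * num_subgroups (q ^ i)"
    using nontrivially_acting_prime_power[OF p7 m m7] .
  have o: "order G = n * (7 * c)" using m c by simp
  then have qc: "q dvd 7 * c" using q(5) c(7) by (simp add: n_def)
  have "q \<le> 6" using q(2) by (simp add: dvd_imp_le)
  then have "q \<noteq> 7" by simp
  have neq: "7 ^ 1 * c \<noteq> r ^ j" if "prime r" for r j
  proof (cases "r = 7")
    case False
    have "7 dvd 7 ^ 1 * c" by simp
    then show ?thesis using prime_dvd_neq_prime_power[OF p7 that] False by blast
  qed (use prime_power_times_coprime_neq[OF p7 c(2,3)] in blast)
  have neq7: "7 ^ 1 \<noteq> r ^ j" if "prime r" "r \<noteq> 7" for r j :: nat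
    using prime_powers_distinct[OF p7 that(1), of 1 j] that(2) by simp
  have oneq: "order G \<noteq> r ^ j" if "prime r" for r j using order_not_prime_power[OF that] .
  have "sum_list (map num_subgroups [7 ^ 1, 7 ^ 1 * c, q ^ i]) \<le> 56"
    using neq[OF p7, of 1] neq[OF p7, of 0] neq[OF q(1), of i] neq7[OF q(1) \<open>q \<noteq> 7\<close>, of i]
      one_less_power[OF prime_gt_1_nat[OF q(1)] q(3)] oneq[OF p7, of 1] oneq[OF q(1), of i] c(4)
    by (intro sum_num_le) auto
  then have "n \<le> 14" using q(6) c(5) by (simp add: n_def)
  then have n: "n = 8" using c(6,7) by presburger
  have q23: "q = 2 \<or> q = 3"
  proof -
    have "q dvd 2 * 3" using q(2) by simp
    then have "q dvd 2 \<or> q dvd 3" using q(1) by (simp only: prime_dvd_mult_iff)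
    then show ?thesis using q(1) primes_dvd_imp_eq[of q 2] primes_dvd_imp_eq[of q 3] by auto
  qed
  then show False
  proof
    assume [simp]: "q = 2"
    then obtain c' where "c = 2 * c'" using qc by (auto simp: prime_dvd_mult_iff elim!: dvdE)
    then have "2 ^ 4 dvd order G" using o n by simp
    have "d \<noteq> 2 ^ j" if "d \<in> set [7 ^ 1, 7 ^ 1 * c]" for d j
      using that neq[OF p2, of j] neq7[OF p2, of j] by auto
    then have "sum_list (map num_subgroups [7 ^ 1, 7 ^ 1 * c]) + num_subgroups (2 ^ i) + 5 * (4 - 1) \<le> 56"
      by (rule sum_num_with_two_powers_le[rotated 2])
        (use neq[OF p7, of 1] oneq[OF p7, of 1] c(4) q(3,4) \<open>2 ^ 4 dvd order G\<close> in auto)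
    then show False using q(6) c(5) n by (simp add: n_def)
  next
    assume [simp]: "q = 3"
    have two: "2 ^ 1 dvd order G" "2 ^ 3 dvd order G" using o n by auto
    have p3: "prime (3::nat)" by simp
    have "d \<noteq> 2 ^ j" if "d \<in> set [7 ^ 1, 7 ^ 1 * c, 3 ^ i]" for d j
      using that neq[OF p2, of j] neq7[OF p2, of j] prime_powers_distinct[OF p3 p2 _ q(3), of j] by auto
    then have "sum_list (map num_subgroups [7 ^ 1, 7 ^ 1 * c, 3 ^ i]) + num_subgroups (2 ^ 1) + 5 * (3 - 1) \<le> 56"
      by (rule sum_num_with_two_powers_le[rotated 2])
        (use neq[OF p7, of 1] neq[OF p3, of i] neq7[OF p3, of i] oneq[OF p7, of 1] oneq[OF p3, of i]
          c(4) q(3,4) two in auto)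
    then show False using q(6) c(5) n num_ge_5[OF p2 _ two(1)] by (simp add: n_def)
  qed
qed

lemma prime_divisor_cases:
  assumes "prime p" "p dvd order G"
  shows "p = 2 \<or> p = 3 \<or> p = 5"
proof -
  have "p < 11" using no_prime_ge_11 assms not_less by blast
  moreover have "p \<noteq> 7" using not_7_dvd_order assms by auto
  moreover have "p \<noteq> 4" "p \<noteq> 6" "p \<noteq> 8" "p \<noteq> 9" "p \<noteq> 10" using assms(1) by auto
  ultimately show ?thesis using prime_ge_2_nat[OF assms(1)] by linarith
qed


text \<open>
  The acting subgroup is a 2-group with at least 15 conjugates, which leaves 6, 11 or 16 Sylow
  5-subgroups; 11 is not a divisor of \<open>|G|\<close>, and with 16 there would be too many orders of
  2-groups. With 6 Sylow subgroups and 6 normalizers, 27 subgroups are found. Orders divisible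
  by 3 contribute at least 20 more. If 8 divides \<open>|G|\<close>, two of the orders 2, 4 and 8 contribute another 10;
  otherwise one of the orders 2 and 4 does so together with the normalizers of the Sylow
  2-subgroups. The sum exceeds the budget by one.
\<close>

lemma not_5_dvd_order: "\<not> 5 dvd order G"
proof
  assume "5 dvd order G"
  then obtain m where m: "order G = 5 * m" by (rule dvdE)
  have p2: "prime (2::nat)" and p3: "prime (3::nat)" and p5: "prime (5::nat)" by simp_all
  have m5: "\<not> 5 dvd m" using not_25_dvd_order m by auto
  define n where "n = num_subgroups (5 ^ 1)"
  obtain c where c: "m = n * c" "\<not> 5 dvd c" "c \<noteq> 1" "5 ^ 1 * c \<noteq> order G"
    "n \<le> num_subgroups (5 ^ 1 * c)" "n mod 5 = 1" "5 \<le> n"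
    using sylow_normalizer_order[OF p5, of 1 m] m m5 unfolding n_def by auto
  obtain q i where q: "prime q" "q dvd 5 - 1" "0 < i" "q ^ i dvd order G"
    "q dvd order G div num_subgroups 5" "5 * (5 + 1) \<le> 2 * num_subgroups (q ^ i)"
    using nontrivially_acting_prime_power[OF p5 m m5] .
  have "q dvd 2 ^ 2" using q(2) by simp
  then have [simp]: "q = 2" using q(1) p2 by (metis prime_dvd_power primes_dvd_imp_eq)
  have o: "order G = n * (5 * c)" using m c by simp
  then have "2 dvd 5 * c" using q(5) c(7) by (simp add: n_def)
  then have "2 dvd c" using p2 by (auto simp: prime_dvd_mult_iff)
  then obtain c' where c': "c = 2 * c'" by (rule dvdE)
  have neq: "5 ^ 1 * c \<noteq> r ^ j" if "prime r" for r j
  proof (cases "r = 5")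
    case False
    have "5 dvd 5 ^ 1 * c" by simp
    then show ?thesis using prime_dvd_neq_prime_power[OF p5 that] False by blast
  qed (use prime_power_times_coprime_neq[OF p5 c(2,3)] in blast)
  have neq5: "5 ^ 1 \<noteq> r ^ j" if "prime r" "r \<noteq> 5" for r j :: nat
    using prime_powers_distinct[OF p5 that(1), of 1 j] that(2) by simp
  have oneq: "order G \<noteq> r ^ j" if "prime r" for r j using order_not_prime_power[OF that] .
  have bound: "2 * n + 15 + 5 * (k - 1) \<le> 56" if k: "2 ^ k dvd order G" for k
  proof -
    have "d \<noteq> 2 ^ j" if "d \<in> set [5 ^ 1, 5 ^ 1 * c]" for d j
      using that neq[OF p2, of j] neq5[OF p2, of j] by auto
    then have "sum_list (map num_subgroups [5 ^ 1, 5 ^ 1 * c]) + num_subgroups (2 ^ i) + 5 * (k - 1) \<le> 56"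
      by (rule sum_num_with_two_powers_le[rotated 2])
        (use neq[OF p5, of 1] oneq[OF p5, of 1] c(4) q(3,4) k in auto)
    then show ?thesis using q(6) c(5) by (simp add: n_def)
  qed
  have "n \<le> 20" using bound[of 0] by simp
  then have "n = 6 \<or> n = 11 \<or> n = 16" using c(6,7) by presburger
  moreover have "n \<noteq> 11" using no_prime_ge_11[of 11] o by auto
  moreover have "n \<noteq> 16" using bound[of 4] o by auto
  ultimately have n: "n = 6" by simp
  have "3 ^ 1 dvd order G" using o n by simp
  then obtain b m3 where m3: "order G = 3 ^ b * m3" "\<not> 3 dvd m3" "1 \<le> b"
    by (rule order_decompose[OF p3])
  define s where "s = num_subgroups (3 ^ b)"
  obtain c3 where c3: "m3 = s * c3" "\<not> 3 dvd c3" "b \<le> 2 \<Longrightarrow> c3 \<noteq> 1"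
    "3 ^ b * c3 \<noteq> order G" "s \<le> num_subgroups (3 ^ b * c3)" "s mod 3 = 1" "5 \<le> s"
    using sylow_normalizer_order[OF p3 m3(1,2)] m3(3) unfolding s_def
    by (metis less_le_trans zero_less_one)
  have so: "order G = s * (3 ^ b * c3)" using m3 c3 by simp
  have "s \<noteq> 7" using not_7_dvd_order so by auto
  then have s10: "10 \<le> s" using c3(6,7) by presburger
  have five: "5 \<le> num_subgroups (3 ^ j)" if "0 < j" "j \<le> b" for j
    by (rule num_ge_5[OF p3 that(1)]) (use m3 that in \<open>auto intro: dvd_mult2 le_imp_power_dvd\<close>)
  \<comment> \<open>Three powers of three, or a power and the order of the normalizer of a Sylow 3-subgroup.\<close>
  obtain ds where ds: "distinct ds" "20 \<le> sum_list (map num_subgroups ds)"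
    "\<And>d. d \<in> set ds \<Longrightarrow> d \<noteq> order G \<and> 3 dvd d \<and> ((\<exists>j. d = 3 ^ j) \<or> s * d = order G)"
  proof (cases "b \<le> 2")
    case True
    have "3 ^ b * c3 \<noteq> 3 ^ b"
      by (rule prime_power_times_coprime_neq[OF p3 c3(2) c3(3)[OF True]])
    then show ?thesis
      using s10 c3(4,5) so oneq[OF p3, of b] m3(3)
      by (intro that[of "[3 ^ b, 3 ^ b * c3]"]) (auto simp: s_def)
  next
    case False
    then have "b \<noteq> 1" "b \<noteq> 2" "2 \<le> b" by auto
    then show ?thesis
      using s10 five[of 1] five[of 2] oneq[OF p3, of b] oneq[OF p3, of 1] oneq[OF p3, of 2]
        power_inject_exp[of "3::nat" 1 b] power_inject_exp[of "3::nat" 2 b]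
      by (intro that[of "[3 ^ 1, 3 ^ 2, 3 ^ b]"])
        (auto simp: s_def intro: exI[of _ 1] exI[of _ 2] exI[of _ b] dvd_power)
  qed
  have ds5: "d \<noteq> 5 ^ 1" "d \<noteq> 5 ^ 1 * c" "d \<noteq> 2 ^ j" if d: "d \<in> set ds" for d j
  proof -
    show "d \<noteq> 5 ^ 1" "d \<noteq> 2 ^ j"
      using prime_dvd_neq_prime_power[OF p3 p5, of d 1] prime_dvd_neq_prime_power[OF p3 p2, of d j] ds(3)[OF d]
      by auto
    show "d \<noteq> 5 ^ 1 * c"
    proof
      assume e: "d = 5 ^ 1 * c"
      then have "s * d = order G" using ds(3)[OF d] neq[OF p3] by auto
      then have "s * d = 6 * d" using e o n by simp
      moreover have "d \<noteq> 0" using \<open>s * d = order G\<close> order_gt_one by (metis mult_0_right not_less_zero)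
      ultimately show False using s10 by simp
    qed
  qed
  have "2 ^ 2 dvd order G" using o n c' by simp
  then obtain a m2 where m2: "order G = 2 ^ a * m2" "\<not> 2 dvd m2" "2 \<le> a"
    by (rule order_decompose[OF p2])
  show False
  proof (cases "3 \<le> a")
    case True
    then have k: "2 ^ 3 dvd order G" using m2(1) le_imp_power_dvd[OF True, of "2::nat"] by simp
    have "d \<noteq> 2 ^ j" if "d \<in> set ([5 ^ 1, 5 ^ 1 * c] @ ds)" for d j
      using that neq[OF p2, of j] neq5[OF p2, of j] ds5(3)[of d j] by auto
    then have "sum_list (map num_subgroups ([5 ^ 1, 5 ^ 1 * c] @ ds)) + num_subgroups (2 ^ i) + 5 * (3 - 1) \<le> 56"
      by (rule sum_num_with_two_powers_le[rotated 2])
        (use neq[OF p5, of 1] oneq[OF p5, of 1] c(4) q(3,4) k ds(1,3) ds5(1,2) in auto)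
    then show False using q(6) c(5) ds(2) n by (simp add: n_def)
  next
    case False
    then have a: "a = 2" using m2(3) by simp
    define u where "u = num_subgroups (2 ^ 2)"
    obtain c2 where c2: "m2 = u * c2" "\<not> 2 dvd c2" "c2 \<noteq> 1"
      "2 ^ 2 * c2 \<noteq> order G" "u \<le> num_subgroups (2 ^ 2 * c2)" "u mod 2 = 1" "5 \<le> u"
      using sylow_normalizer_order[OF p2, of 2 m2] m2 a unfolding u_def by auto
    have uo: "order G = u * (2 ^ 2 * c2)" using m2 a c2 by simp
    have "c2 \<noteq> 0" using c2(2) by (metis dvd_0_right)
    then have c2pos: "2 ^ 2 * c2 \<noteq> 0" by simp
    \<comment> \<open>Five is the only prime that may divide both numbers of Sylow subgroups.\<close>
    have us: "u \<noteq> s"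
    proof
      assume us: "u = s"
      have r5: "r = 5" if "prime r" "r dvd u" for r
      proof -
        have "r dvd order G" using that uo by auto
        moreover have "r \<noteq> 2" using that c2(6) by auto
        moreover have "r \<noteq> 3" using that us c3(6) by auto
        ultimately show ?thesis using prime_divisor_cases that by blast
      qed
      have "u \<noteq> 1" using c2(7) by simp
      then have "5 dvd u" using prime_factor_nat[of u] r5 by blast
      then obtain v where v: "u = 5 * v" by (rule dvdE)
      have "v \<noteq> 1" using v us c3(6) by auto
      then obtain r where r: "prime r" "r dvd v" using prime_factor_nat[of v] by blast
      then have "5 dvd v" using r5[of r] v by auto
      then show False using not_25_dvd_order uo v by auto
    qed
    have neq4: "2 ^ 2 * c2 \<noteq> r ^ j" if "prime r" for r j
    proof (cases "r = 2")
      case False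
      have "2 dvd 2 ^ 2 * c2" by simp
      then show ?thesis using prime_dvd_neq_prime_power[OF p2 that] False by blast
    qed (use prime_power_times_coprime_neq[OF p2 c2(2,3)] in blast)
    have "2 ^ 2 * c2 \<noteq> 5 ^ 1 * c"
    proof
      assume "2 ^ 2 * c2 = 5 ^ 1 * c"
      then have "u * (2 ^ 2 * c2) = 6 * (2 ^ 2 * c2)" using uo o n by simp
      then show False using c2pos c2(6) by simp
    qed
    moreover have "2 ^ 2 * c2 \<notin> set ds"
    proof
      assume d: "2 ^ 2 * c2 \<in> set ds"
      then have "s * (2 ^ 2 * c2) = u * (2 ^ 2 * c2)" using ds(3)[OF d] neq4[OF p3] uo by auto
      then show False using c2pos us by simp
    qed
    moreover have "2 ^ 2 * c2 \<noteq> 5 ^ 1" using neq4[OF p5, of 1] .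
    ultimately have dist: "distinct ([5 ^ 1, 5 ^ 1 * c, 2 ^ 2 * c2] @ ds)"
      using neq[OF p5, of 1] ds(1) ds5(1,2) by auto
    have "d \<noteq> 2 ^ j" if "d \<in> set ([5 ^ 1, 5 ^ 1 * c, 2 ^ 2 * c2] @ ds)" for d j
      using that neq[OF p2, of j] neq5[OF p2, of j] ds5(3)[of d j] neq4[OF p2, of j] by auto
    then have "sum_list (map num_subgroups ([5 ^ 1, 5 ^ 1 * c, 2 ^ 2 * c2] @ ds))
        + num_subgroups (2 ^ i) + 5 * (2 - 1) \<le> 56"
      by (rule sum_num_with_two_powers_le[OF dist, rotated])
        (use oneq[OF p5, of 1] c(4) c2(4) q(3,4) \<open>2 ^ 2 dvd order G\<close> ds(3) in auto)
    then show False using q(6) c(5) ds(2) n c2(5,7) by (simp add: n_def)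
  qed
qed

section \<open>Orders with prime divisors two and three\<close>

text \<open>
  All primes other than 2 and 3 are excluded, and \<open>|G|\<close> is not a prime power.
\<close>

lemma order_two_three:
  obtains a b where "order G = 2 ^ a * 3 ^ b" "0 < a" "0 < b"
proof -
  have p2: "prime (2::nat)" and p3: "prime (3::nat)" by simp_all
  obtain a m where m: "order G = 2 ^ a * m" "\<not> 2 dvd m" using order_decompose[OF p2, of 0] by auto
  have "m \<noteq> 0" using m(2) by (metis dvd_0_right)
  then obtain m' where m': "m = 3 ^ multiplicity 3 m * m'" "\<not> 3 dvd m'"
    using multiplicity_decompose'[of m 3] p3 not_prime_unit by blast
  have "m' = 1"
  proof (rule ccontr)
    assume "m' \<noteq> 1"
    then obtain r where r: "prime r" "r dvd m'" using prime_factor_nat by blast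
    have rm: "r dvd m" using r m' by (metis dvd_mult)
    then have "r dvd order G" using m by simp
    then have "r = 2 \<or> r = 3 \<or> r = 5" using prime_divisor_cases r by blast
    then show False using r m' m rm not_5_dvd_order \<open>r dvd order G\<close> by auto
  qed
  then have o: "order G = 2 ^ a * 3 ^ multiplicity 3 m" using m m' by simp
  moreover have "0 < a" using o order_not_prime_power[OF p3] by (cases a) auto
  moreover have "0 < multiplicity 3 m"
    using o order_not_prime_power[OF p2, of a] by (cases "multiplicity 3 m") auto
  ultimately show ?thesis by (rule that)
qed

text \<open>
  Here \<open>|G| = 2\<^sup>a 3\<^sup>b\<close>. The number of Sylow 3-subgroups is a power of 4 above 4, hence at least 16, so
  16 divides \<open>|G|\<close>; the number of Sylow 2-subgroups is a power of 3 from 9 on. If \<open>b = 2\<close>, the Sylow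
  3-subgroups are abelian and their normalizers contribute another 16. If \<open>b \<ge> 3\<close>, there are either at least
  27 Sylow 2-subgroups, or 9 of them and 9 normalizers that are larger.
\<close>

lemma no_two_three: False
proof -
  obtain a b where o: "order G = 2 ^ a * 3 ^ b" "0 < a" "0 < b" using order_two_three .
  have p2: "prime (2::nat)" and p3: "prime (3::nat)" by simp_all
  have nd: "\<not> 2 dvd (3::nat) ^ b" "\<not> 3 dvd (2::nat) ^ a"
    using prime_dvd_power[OF p2, of 3 b] prime_dvd_power[OF p3, of 2 a] by (auto dest: dvd_imp_le)
  define s u where "s = num_subgroups (3 ^ b)" and "u = num_subgroups (2 ^ a)"
  obtain c where c: "2 ^ a = s * c" "\<not> 3 dvd c" "b \<le> 2 \<Longrightarrow> c \<noteq> 1" "3 ^ b * c \<noteq> order G"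
    "s \<le> num_subgroups (3 ^ b * c)" "s mod 3 = 1" "5 \<le> s"
    using sylow_normalizer_order[OF p3 _ nd(2) o(3)] o(1) unfolding s_def by (metis mult.commute)
  obtain e where e: "3 ^ b = u * e" "\<not> 2 dvd e" "2 ^ a * e \<noteq> order G"
    "u \<le> num_subgroups (2 ^ a * e)" "5 \<le> u"
    using sylow_normalizer_order[OF p2 o(1) nd(1) o(2)] unfolding u_def by metis
  obtain j where j: "s = 2 ^ j" "j \<le> a" using divides_primepow_nat[OF p2] c(1) by (metis dvd_triv_left)
  have "j \<notin> {0, 1, 2, 3}"
  proof
    assume "j \<in> {0, 1, 2, 3}"
    then have "s \<in> {1, 2, 4, 8}" using j(1) by auto
    then show False using c(6,7) by auto
  qed
  then have j4: "4 \<le> j" by auto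
  then have s16: "16 \<le> s" using power_increasing[of 4 j "2::nat"] j(1) by simp
  have a4: "4 \<le> a" using j4 j(2) by simp
  obtain k where k: "u = 3 ^ k" "k \<le> b" using divides_primepow_nat[OF p3] e(1) by (metis dvd_triv_left)
  have "k \<notin> {0, 1}"
  proof
    assume "k \<in> {0, 1}"
    then have "u \<in> {1, 3}" using k(1) by auto
    then show False using e(5) by auto
  qed
  then have k2: "2 \<le> k" by auto
  then have u9: "9 \<le> u" using power_increasing[of 2 k "3::nat"] k(1) by simp
  have two: "2 ^ a dvd order G" "2 ^ 4 dvd order G"
    using o(1) le_imp_power_dvd[OF a4, of "2::nat"] by (auto intro: dvd_mult2)
  have five: "5 \<le> num_subgroups (3 ^ i)" if "0 < i" "i \<le> b" for i
    by (rule num_ge_5[OF p3 that(1)]) (use o that in \<open>auto intro: dvd_mult le_imp_power_dvd\<close>)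
  have oneq: "order G \<noteq> r ^ i" if "prime r" for r i using order_not_prime_power[OF that] .
  have n32: "3 ^ i \<noteq> (2::nat) ^ l" if "0 < i" for i l using prime_powers_distinct[OF p3 p2 _ that] by simp
  show False
  proof (cases "b = 2")
    case True
    have neq: "3 ^ 2 * c \<noteq> 3 ^ l" for l
      by (rule prime_power_times_coprime_neq[OF p3 c(2)]) (use c(3) True in simp)
    have "3 dvd 3 ^ 2 * c" by (rule dvd_mult2) simp
    then have neq2: "3 ^ 2 * c \<noteq> 2 ^ l" for l
      using prime_dvd_neq_prime_power[OF p3 p2] by simp
    have "d \<noteq> 2 ^ l" if "d \<in> set [3 ^ 1, 3 ^ 2, 3 ^ 2 * c]" for d l
      using that neq2[of l] n32[of 1 l] n32[of 2 l] by auto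
    then have "sum_list (map num_subgroups [3 ^ 1, 3 ^ 2, 3 ^ 2 * c]) + num_subgroups (2 ^ a) + 5 * (4 - 1) \<le> 56"
      by (rule sum_num_with_two_powers_le[rotated 2])
        (use neq[of 1] neq[of 2] oneq[OF p3, of 1] oneq[OF p3, of 2] c(4) o(2) two True in auto)
    then show False using five[of 1] c(5) s16 u9 True by (simp add: s_def u_def)
  next
    case False
    then have b3: "3 \<le> b" using k(2) k2 by simp
    have n3: "(3::nat) ^ 1 \<noteq> 3 ^ 2" "(3::nat) ^ 1 \<noteq> 3 ^ b" "(3::nat) ^ 2 \<noteq> 3 ^ b"
      using b3 power_inject_exp[of "3::nat" 1 b] power_inject_exp[of "3::nat" 2 b] by auto
    have tp: "d \<noteq> 2 ^ l" if "d \<in> set [3 ^ 1, 3 ^ 2, 3 ^ b]" for d l :: nat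
      using that n32[of 1 l] n32[of 2 l] n32[of b l] b3 by auto
    show False
    proof (cases "k = 2")
      case True
      have "e \<noteq> 1" using e(1) k(1) True n3(3) by auto
      then have neq: "2 ^ a * e \<noteq> 2 ^ l" for l by (rule prime_power_times_coprime_neq[OF p2 e(2)])
      have "2 dvd 2 ^ a * e" using o(2) by simp
      then have neq3: "2 ^ a * e \<noteq> 3 ^ l" for l
        using prime_dvd_neq_prime_power[OF p2 p3] by simp
      have "d \<noteq> 2 ^ l" if "d \<in> set [3 ^ 1, 3 ^ 2, 3 ^ b, 2 ^ a * e]" for d l
        using that tp[of d l] neq[of l] by auto
      then have "sum_list (map num_subgroups [3 ^ 1, 3 ^ 2, 3 ^ b, 2 ^ a * e]) + num_subgroups (2 ^ a) + 5 * (4 - 1) \<le> 56"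
        by (rule sum_num_with_two_powers_le[rotated 2])
          (use n3 neq3[of 1] neq3[of 2] neq3[of b] oneq[OF p3, of 1] oneq[OF p3, of 2] oneq[OF p3, of b]
            e(3) o(2) two in auto)
      then show False using five[of 1] five[of 2] e(4) s16 u9 b3 by (simp add: s_def u_def)
    next
      case False
      then have "3 \<le> k" using k2 by simp
      then have u27: "27 \<le> u" using power_increasing[of 3 k "3::nat"] k(1) by simp
      from tp have "sum_list (map num_subgroups [3 ^ 1, 3 ^ 2, 3 ^ b]) + num_subgroups (2 ^ a) + 5 * (4 - 1) \<le> 56"
        by (rule sum_num_with_two_powers_le[rotated 2])
          (use n3 oneq[OF p3, of 1] oneq[OF p3, of 2] oneq[OF p3, of b] o(2) two in auto)
      then show False using five[of 1] five[of 2] s16 u27 b3 by (simp add: s_def u_def)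
    qed
  qed
qed

end

theorem (in nonabelian_simple_group) Sub_ge_59: "59 \<le> Sub G"
proof (rule ccontr)
  assume "\<not> 59 \<le> Sub G"
  then have "few_subgroups G"
    using nonabelian_simple_group_axioms by (simp add: few_subgroups_def few_subgroups_axioms_def)
  then show False by (rule few_subgroups.no_two_three)
qed

section \<open>Reduction to simple groups\<close>

lemma (in group) Sub_subgroup_le:
  assumes fin: "finite (carrier G)" and K: "subgroup K G"
  shows "Sub (G\<lparr>carrier := K\<rparr>) \<le> Sub G"
proof -
  have "{H. subgroup H (G\<lparr>carrier := K\<rparr>)} \<subseteq> {H. subgroup H G}"
    using incl_subgroup[OF K] by blast
  then show ?thesis
    unfolding Sub_def using finite_subgroups[OF fin, of "\<lambda>_. True"] by (intro card_mono) auto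
qed

text \<open>
  A subgroup of the quotient is determined by the union of its cosets, a subgroup of \<open>G\<close>.
\<close>

lemma (in normal) Sub_quotient_le:
  assumes fin: "finite (carrier G)"
  shows "Sub (G Mod H) \<le> Sub G"
proof -
  have "inj_on \<Union> {A. subgroup A (G Mod H)}"
    by (rule inj_onI) (metis factgroup_subgroup_union_factor mem_Collect_eq)
  moreover have "\<Union> ` {A. subgroup A (G Mod H)} \<subseteq> {K. subgroup K G}"
    using factgroup_subgroup_union_subgroup by blast
  moreover have "finite {K. subgroup K G}" using finite_subgroups[OF fin, of "\<lambda>_. True"] by simp
  ultimately show ?thesis unfolding Sub_def by (rule card_inj_on_le)
qed

lemma (in group) perfect_core:
  assumes fin: "finite (carrier G)" and ns: "\<not> solvable G"
  obtains D where "subgroup D G" "derived G D = D" "D \<noteq> {\<one>}"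
proof -
  let ?D = "\<lambda>n. (derived G ^^ n) (carrier G)"
  have sub: "subgroup (?D n) G" for n by (rule exp_of_derived_is_subgroup[OF subgroup_self])
  have finD: "finite (?D n)" for n using finite_subset[OF subgroup.subset[OF sub] fin] .
  have step: "derived G (?D n) \<subseteq> ?D n" for n by (rule derived_incl[OF _ sub]) simp
  have "\<exists>n. derived G (?D n) = ?D n"
  proof (rule ccontr)
    assume "\<not> ?thesis"
    then have ne: "?D (Suc n) \<noteq> ?D n" for n by simp
    have lt: "card (?D (Suc n)) < card (?D n)" for n
      using psubset_card_mono[OF finD[of n]] step[of n] ne[of n] by (simp add: psubset_eq)
    have "card (?D n) + n \<le> card (carrier G)" for n
    proof (induction n)
      case (Suc n)
      then show ?case using lt[of n] by linarith
    qed simp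
    from this[of "Suc (card (carrier G))"] show False by simp
  qed
  then obtain n where "derived G (?D n) = ?D n" by blast
  moreover have "?D n \<noteq> {\<one>}" using ns solvable_iff_trivial_derived_seq by blast
  ultimately show ?thesis using that sub by blast
qed

text \<open>
  For a maximal normal subgroup \<open>N\<close> the quotient is simple, and if it were abelian, \<open>N\<close> would contain
  the derived subgroup.
\<close>

lemma (in group) nonabelian_simple_quotient_of_perfect:
  assumes fin: "finite (carrier G)" and perf: "derived G (carrier G) = carrier G"
    and nt: "carrier G \<noteq> {\<one>}"
  obtains N where "N \<lhd> G" "nonabelian_simple_group (G Mod N)"
proof -
  let ?P = "{N. N \<lhd> G \<and> N \<noteq> carrier G}"
  have finP: "finite ?P"
    by (rule finite_subset[of _ "Pow (carrier G)"]) (use fin in \<open>auto dest: normal_imp_subgroup subgroup.subset\<close>)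
  have "{\<one>} \<in> ?P" using one_is_normal nt by auto
  then have "\<exists>N\<in>?P. \<forall>M\<in>?P. N \<subseteq> M \<longrightarrow> N = M" by (intro finite_has_maximal[OF finP]) auto
  then obtain N where N: "N \<in> ?P" "\<forall>M\<in>?P. N \<subseteq> M \<longrightarrow> N = M" by (rule bexE)
  interpret N: normal N G using N by simp
  interpret Q: group "G Mod N" by (rule N.factorgroup_is_group)
  have finQ: "finite (carrier (G Mod N))" using fin by (simp add: carrier_FactGroup)
  have nc: "\<not> comm_group (G Mod N)"
    using derived_minimal[of N] N(1) perf N.subset by auto
  have "nonabelian_simple_group (G Mod N)"
  proof (unfold_locales)
    have "carrier (G Mod N) \<noteq> {\<one>\<^bsub>G Mod N\<^esub>}"
      using nc Q.group_comm_groupI by auto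
    then have "order (G Mod N) \<noteq> 1" using Q.order_one_triv_iff by simp
    then show "1 < order (G Mod N)" using finQ Q.order_gt_0_iff_finite by linarith
    show "finite (carrier (G Mod N))" by (rule finQ)
    show "\<exists>x\<in>carrier (G Mod N). \<exists>y\<in>carrier (G Mod N). x \<otimes>\<^bsub>G Mod N\<^esub> y \<noteq> y \<otimes>\<^bsub>G Mod N\<^esub> x"
      using nc Q.group_comm_groupI by blast
    fix A assume A: "A \<lhd> G Mod N"
    have sA: "subgroup A (G Mod N)" using A normal_imp_subgroup by blast
    have U: "\<Union>A = {x \<in> carrier G. N #> x \<in> A}" by (rule N.factgroup_subgroup_union_char[OF sA])
    have nU: "\<Union>A \<lhd> G" by (rule N.factgroup_subgroup_union_normal[OF A])
    have "N \<in> A" using subgroup.one_closed[OF sA] by simp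
    then have NU: "N \<subseteq> \<Union>A" by auto
    have Ac: "A = rcosets\<^bsub>G\<lparr>carrier := \<Union>A\<rparr>\<^esub> N" by (rule N.factgroup_subgroup_union_factor[OF sA])
    show "A = carrier (G Mod N) \<or> A = {\<one>\<^bsub>G Mod N\<^esub>}"
    proof (cases "\<Union>A = carrier G")
      case True
      then show ?thesis using Ac by (simp add: FactGroup_def)
    next
      case False
      then have "N = \<Union>A" using N(2) NU nU by simp
      then have UN: "\<Union>A = N" by simp
      have "A \<subseteq> {N}"
      proof
        fix B assume B: "B \<in> A"
        then have "B \<in> carrier (G Mod N)" using subgroup.subset[OF sA] by (rule subsetD[rotated])
        then obtain x where x: "x \<in> carrier G" "B = N #> x" by (auto simp: carrier_FactGroup)
        then have "x \<in> \<Union>A" using U B by simp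
        then show "B \<in> {N}" using coset_join2[OF x(1) N.subgroup_axioms] UN x(2) by simp
      qed
      then show ?thesis using \<open>N \<in> A\<close> by auto
    qed
  qed
  then show ?thesis using that N by blast
qed

theorem theorem2p1:
  fixes G :: "('a, 'b) monoid_scheme"
  assumes "group G" and "finite (carrier G)"
    and "Sub G < 59"
  shows "solvable G"
proof (rule ccontr)
  interpret group G by fact
  assume "\<not> solvable G"
  then obtain D where D: "subgroup D G" "derived G D = D" "D \<noteq> {\<one>\<^bsub>G\<^esub>}"
    by (rule perfect_core[OF assms(2)])
  let ?D = "G\<lparr>carrier := D\<rparr>"
  interpret D: group ?D by (rule subgroup_imp_group[OF D(1)])
  have finD: "finite (carrier ?D)" using finite_subset[OF subgroup.subset[OF D(1)] assms(2)] by simp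
  have "derived ?D (carrier ?D) = carrier ?D" "carrier ?D \<noteq> {\<one>\<^bsub>?D\<^esub>}"
    using derived_consistent[OF subset_refl D(1)] D(2,3) by simp_all
  then obtain N where N: "N \<lhd> ?D" "nonabelian_simple_group (?D Mod N)"
    by (rule D.nonabelian_simple_quotient_of_perfect[OF finD])
  have "Sub (?D Mod N) \<le> Sub ?D" by (rule normal.Sub_quotient_le[OF N(1) finD])
  also have "\<dots> \<le> Sub G" by (rule Sub_subgroup_le[OF assms(2) D(1)])
  finally have "Sub (?D Mod N) < 59" using assms(3) by simp
  then show False using nonabelian_simple_group.Sub_ge_59[OF N(2)] by simp
qed

end
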